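(* Let $M$ be a sharp, integral monoid, $\Gamma$ an $M$-metrised graph, and $G$ its underlying graph. Then there is a subdivision $H$ of $G$ such that $\operatorname{dgon}(\Gamma)\ge\operatorname{dgon}(H)$.
   Context: Monoids are commutative, sharp (only unit $0$), integral (cancellative), with groupification; $\langle m\rangle=\{km:k\in\mathbb Z\}$ and for $x=km$, $m\ne0$, $x/m:=k$. A graph is $(X,r,i)$, $X$ finite, $r$ idempotent, $i$ an involution, $i(x)=x\iff r(x)=x$; vertices $V$ = fixed points, half-edges $H=X\setminus V$, edges $\{e,i(e)\}$ joining $r(e),r(i(e))$, $H_v=\{e\in H:r(e)=v\}$; graphs are connected. An $M$-metrised graph adds $l:X\to M$ with $l(i(x))=l(x)$, $l(x)=0\iff x\in V$; its underlying graph is $(X,r,i)$. Divisors: free abelian group on $V$, pointwise order. $\operatorname{PL}(\Gamma)=\{g:V\to M^{gp}: g(r(e))-g(r(i(e)))\in\langle l(e)\rangle\ \forall e\in H\}$; $\Delta(g)=\sum_{v}\big(\sum_{e\in H_v}\frac{g(v)-g(r(i(e)))}{l(e)}\big)[v]$; $D\sim D'$ iff $D-D'\in\Delta(\operatorname{PL}(\Gamma))$; $|D|=\{E\ge0:E\sim D\}$; $r(D)=\max\{k:|D-F|\ne\emptyset$ for all effective $F$ of degree $k\}$; $\operatorname{dgon}(\Gamma)=\min\{\deg D: r(D)\ge1\}$. The divisorial gonality of an unmetrised graph is that of the $\mathbb N$-metrised graph with all lengths $1$. A subdivision operation replaces an edge $\{e,i(e)\}$ by a new vertex $w$ and two edges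 joining $r(e)$ to $w$ and $w$ to $r(i(e))$; a subdivision of $G$ is a graph obtained by finitely many such operations. *)

theory Defs
  imports Main
begin

section \<open>Monoids\<close>

text \<open>A commutative, sharp, integral monoid is represented as a submonoid M of an
abelian group 'g (every integral monoid embeds in its groupification).  The
groupification of M is the subgroup generated by M.\<close>

definition sharp_integral_monoid :: "'g::ab_group_add set \<Rightarrow> bool" where
  "sharp_integral_monoid M \<longleftrightarrow>
     0 \<in> M \<and> (\<forall>a\<in>M. \<forall>b\<in>M. a + b \<in> M) \<and> (\<forall>a\<in>M. - a \<in> M \<longrightarrow> a = 0)"

definition Mgp :: "'g::ab_group_add set \<Rightarrow> 'g set" where
  "Mgp M = {a - b | a b. a \<in> M \<and> b \<in> M}"

text \<open>Integer multiples in an abelian group.\<close>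
definition zsmul :: "int \<Rightarrow> 'g::ab_group_add \<Rightarrow> 'g" where
  "zsmul k x = (if 0 \<le> k then (((+) x) ^^ nat k) 0 else - ((((+) x) ^^ nat (- k)) 0))"

definition zspan :: "'g::ab_group_add \<Rightarrow> 'g set" where
  "zspan m = {zsmul k m | k. True}"

text \<open>x / m := k for x = k m, m nonzero.\<close>
definition zquot :: "'g::ab_group_add \<Rightarrow> 'g \<Rightarrow> int" where
  "zquot x m = (THE k. x = zsmul k m)"

section \<open>Graphs\<close>

definition verts :: "'a set \<Rightarrow> ('a \<Rightarrow> 'a) \<Rightarrow> 'a set" where
  "verts X r = {x \<in> X. r x = x}"

definition hedges :: "'a set \<Rightarrow> ('a \<Rightarrow> 'a) \<Rightarrow> 'a set" where
  "hedges X r = X - verts X r"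

definition hedges_at :: "'a set \<Rightarrow> ('a \<Rightarrow> 'a) \<Rightarrow> 'a \<Rightarrow> 'a set" where
  "hedges_at X r v = {e \<in> hedges X r. r e = v}"

definition adj_rel :: "'a set \<Rightarrow> ('a \<Rightarrow> 'a) \<Rightarrow> ('a \<Rightarrow> 'a) \<Rightarrow> ('a \<times> 'a) set" where
  "adj_rel X r i = {(r e, r (i e)) | e. e \<in> hedges X r}"

definition is_graph :: "'a set \<Rightarrow> ('a \<Rightarrow> 'a) \<Rightarrow> ('a \<Rightarrow> 'a) \<Rightarrow> bool" where
  "is_graph X r i \<longleftrightarrow>
     finite X \<and>
     (\<forall>x\<in>X. r x \<in> X \<and> r (r x) = r x \<and> i x \<in> X \<and> i (i x) = x \<and> (i x = x \<longleftrightarrow> r x = x)) \<and>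
     verts X r \<noteq> {} \<and>
     (\<forall>u\<in>verts X r. \<forall>v\<in>verts X r. (u, v) \<in> (adj_rel X r i)\<^sup>*)"

definition metrised_graph ::
  "'g::ab_group_add set \<Rightarrow> 'a set \<Rightarrow> ('a \<Rightarrow> 'a) \<Rightarrow> ('a \<Rightarrow> 'a) \<Rightarrow> ('a \<Rightarrow> 'g) \<Rightarrow> bool" where
  "metrised_graph M X r i l \<longleftrightarrow> is_graph X r i \<and>
     (\<forall>x\<in>X. l (i x) = l x \<and> l x \<in> M \<and> (l x = 0 \<longleftrightarrow> x \<in> verts X r))"

section \<open>Divisors, linear equivalence, rank, gonality\<close>

definition divisor :: "'a set \<Rightarrow> ('a \<Rightarrow> 'a) \<Rightarrow> ('a \<Rightarrow> int) \<Rightarrow> bool" where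
  "divisor X r D \<longleftrightarrow> (\<forall>v. v \<notin> verts X r \<longrightarrow> D v = 0)"

definition deg :: "'a set \<Rightarrow> ('a \<Rightarrow> 'a) \<Rightarrow> ('a \<Rightarrow> int) \<Rightarrow> int" where
  "deg X r D = (\<Sum>v\<in>verts X r. D v)"

definition effective :: "('a \<Rightarrow> int) \<Rightarrow> bool" where
  "effective D \<longleftrightarrow> (\<forall>v. 0 \<le> D v)"

definition PL ::
  "'g::ab_group_add set \<Rightarrow> 'a set \<Rightarrow> ('a \<Rightarrow> 'a) \<Rightarrow> ('a \<Rightarrow> 'a) \<Rightarrow> ('a \<Rightarrow> 'g) \<Rightarrow> ('a \<Rightarrow> 'g) set" where
  "PL M X r i l = {g. (\<forall>v\<in>verts X r. g v \<in> Mgp M) \<and>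
      (\<forall>e\<in>hedges X r. g (r e) - g (r (i e)) \<in> zspan (l e))}"

definition Laplacian ::
  "'a set \<Rightarrow> ('a \<Rightarrow> 'a) \<Rightarrow> ('a \<Rightarrow> 'a) \<Rightarrow> ('a \<Rightarrow> 'g::ab_group_add) \<Rightarrow> ('a \<Rightarrow> 'g) \<Rightarrow> 'a \<Rightarrow> int" where
  "Laplacian X r i l g v = (if v \<in> verts X r then
      (\<Sum>e\<in>hedges_at X r v. zquot (g v - g (r (i e))) (l e)) else 0)"

definition lin_equiv ::
  "'g::ab_group_add set \<Rightarrow> 'a set \<Rightarrow> ('a \<Rightarrow> 'a) \<Rightarrow> ('a \<Rightarrow> 'a) \<Rightarrow> ('a \<Rightarrow> 'g)
    \<Rightarrow> ('a \<Rightarrow> int) \<Rightarrow> ('a \<Rightarrow> int) \<Rightarrow> bool" where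
  "lin_equiv M X r i l D D' \<longleftrightarrow>
     (\<exists>g\<in>PL M X r i l. \<forall>v. D v - D' v = Laplacian X r i l g v)"

definition lin_sys ::
  "'g::ab_group_add set \<Rightarrow> 'a set \<Rightarrow> ('a \<Rightarrow> 'a) \<Rightarrow> ('a \<Rightarrow> 'a) \<Rightarrow> ('a \<Rightarrow> 'g)
    \<Rightarrow> ('a \<Rightarrow> int) \<Rightarrow> ('a \<Rightarrow> int) set" where
  "lin_sys M X r i l D = {E. divisor X r E \<and> effective E \<and> lin_equiv M X r i l E D}"

text \<open>r(D) = max of k (k \<ge> 0) such that |D - F| is nonempty for all effective F of
degree k; -1 if there is no such k (i.e. |D| is empty).\<close>
definition rank ::
  "'g::ab_group_add set \<Rightarrow> 'a set \<Rightarrow> ('a \<Rightarrow> 'a) \<Rightarrow> ('a \<Rightarrow> 'a) \<Rightarrow> ('a \<Rightarrow> 'g)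
    \<Rightarrow> ('a \<Rightarrow> int) \<Rightarrow> int" where
  "rank M X r i l D =
    (let S = {k::nat. \<forall>F. divisor X r F \<and> effective F \<and> deg X r F = int k \<longrightarrow>
                        lin_sys M X r i l (\<lambda>v. D v - F v) \<noteq> {}}
     in if S = {} then -1 else int (Max S))"

definition dgon ::
  "'g::ab_group_add set \<Rightarrow> 'a set \<Rightarrow> ('a \<Rightarrow> 'a) \<Rightarrow> ('a \<Rightarrow> 'a) \<Rightarrow> ('a \<Rightarrow> 'g) \<Rightarrow> nat" where
  "dgon M X r i l =
     (LEAST n. \<exists>D. divisor X r D \<and> deg X r D = int n \<and> 1 \<le> rank M X r i l D)"

text \<open>Divisorial gonality of an unmetrised graph: N-metrised with all lengths 1
(N realised inside the group int).\<close>
definition udgon :: "'a set \<Rightarrow> ('a \<Rightarrow> 'a) \<Rightarrow> ('a \<Rightarrow> 'a) \<Rightarrow> nat" where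
  "udgon X r i = dgon {n::int. 0 \<le> n} X r i (\<lambda>x. if r x = x then 0 else 1)"

section \<open>Subdivisions\<close>

definition subdivision_step ::
  "'b set \<Rightarrow> ('b \<Rightarrow> 'b) \<Rightarrow> ('b \<Rightarrow> 'b) \<Rightarrow> 'b set \<Rightarrow> ('b \<Rightarrow> 'b) \<Rightarrow> ('b \<Rightarrow> 'b) \<Rightarrow> bool" where
  "subdivision_step Y s j Z t k \<longleftrightarrow>
    (\<exists>e w f f'. e \<in> hedges Y s \<and> w \<notin> Y \<and> f \<notin> Y \<and> f' \<notin> Y \<and> distinct [w, f, f'] \<and>
       Z = Y \<union> {w, f, f'} \<and>
       (\<forall>x\<in>Y. t x = s x) \<and>
       (\<forall>x\<in>Y - {e, j e}. k x = j x) \<and>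
       k e = f \<and> k f = e \<and> k (j e) = f' \<and> k f' = j e \<and> k w = w \<and>
       t w = w \<and> t f = w \<and> t f' = w)"

inductive subdivision ::
  "'b set \<Rightarrow> ('b \<Rightarrow> 'b) \<Rightarrow> ('b \<Rightarrow> 'b) \<Rightarrow> 'b set \<Rightarrow> ('b \<Rightarrow> 'b) \<Rightarrow> ('b \<Rightarrow> 'b) \<Rightarrow> bool"
  for X r i where
  refl: "subdivision X r i X r i"
| step: "subdivision X r i Y s j \<Longrightarrow> subdivision_step Y s j Z t k \<Longrightarrow> subdivision X r i Z t k"

end

theory Submission
  imports Defs
begin

text \<open>A divisor of rank at least one on \<open>\<Gamma>\<close> is witnessed by finitely many piecewise linear
functions, hence by finitely many integral linear relations between elements of the monoid. By
sharpness and Stiemke's lemma these relations have a solution in integers in which every edge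
length stays positive, so the same divisor wins against every vertex on an integrally metrised
copy of \<open>\<Gamma>\<close>. Subdivide every edge that is not a loop into edges of length one; the functions
extend linearly. It remains to win against the new vertices. This works because every cycle other
than a loop still contains two old vertices; it would fail on a subdivided loop, and loops are
irrelevant for the Laplacian, so they are left alone.\<close>

section \<open>Integral solutions of relations in sharp monoids\<close>

text \<open>In general no homomorphism from the monoid to the natural numbers keeps all nonzero
  elements positive: in the nonnegative cone of Z^2 with the lexicographic order, (1,0) exceeds
  every multiple of (0,1), so (0,1) must go to 0. Hence only a finite system is solved, with
  unknowns for the lengths and values that actually occur and one equation for each winning function
  and half-edge. The slopes are the fixed coefficients of this system. A solution therefore changes
  lengths and values but no slope, and the Laplacian depends on slopes alone; this is why the
  divisor and its degree survive.\<close>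

lemma zsmul_0_left [simp]: "zsmul 0 x = 0"
  by (simp add: zsmul_def)

lemma zsmul_plus_1: "zsmul (k + 1) x = x + zsmul k x"
proof (cases "0 \<le> k")
  case True
  then have "nat (k + 1) = Suc (nat k)" by simp
  with True show ?thesis by (simp add: zsmul_def)
next
  case False
  then have "nat (- k) = Suc (nat (- (k + 1)))" by simp
  with False show ?thesis by (auto simp: zsmul_def)
qed

lemma zsmul_minus_1: "zsmul (k - 1) x = zsmul k x - x"
  using zsmul_plus_1[of "k - 1" x] by simp

lemma zsmul_1_left [simp]: "zsmul 1 x = x"
  using zsmul_plus_1[of 0 x] by simp

lemma zsmul_add_left: "zsmul (a + b) x = zsmul a x + zsmul b x"
proof (induction a rule: int_induct[where k = 0])
  case (step1 a)
  then show ?case using zsmul_plus_1[of "a + b" x] zsmul_plus_1[of a x] by (simp add: ac_simps)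
next
  case (step2 a)
  have "zsmul (a - 1 + b) x = zsmul (a + b) x - x"
    using zsmul_minus_1[of "a + b" x] by (simp add: algebra_simps)
  then show ?case by (simp add: step2.IH zsmul_minus_1 algebra_simps)
qed simp

lemma zsmul_minus_left: "zsmul (- a) x = - zsmul a x"
  using zsmul_add_left[of "- a" a x] by (simp add: eq_neg_iff_add_eq_0)

lemma zsmul_diff_left: "zsmul (a - b) x = zsmul a x - zsmul b x"
  using zsmul_add_left[of a "- b" x] by (simp add: zsmul_minus_left)

lemma zsmul_0_right [simp]: "zsmul a 0 = 0"
  by (induction a rule: int_induct[where k = 0]) (simp_all add: zsmul_plus_1 zsmul_minus_1)

lemma zsmul_add_right: "zsmul a (x + y) = zsmul a x + zsmul a y"
  by (induction a rule: int_induct[where k = 0])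
    (simp_all add: zsmul_plus_1 zsmul_minus_1 algebra_simps)

lemma zsmul_mult: "zsmul (a * b) x = zsmul a (zsmul b x)"
  by (induction a rule: int_induct[where k = 0])
    (simp_all add: zsmul_plus_1 zsmul_minus_1 zsmul_add_left zsmul_diff_left algebra_simps)

lemma zsmul_sum_left: "zsmul (\<Sum>t\<in>T. f t) x = (\<Sum>t\<in>T. zsmul (f t) x)"
  by (induction T rule: infinite_finite_induct) (simp_all add: zsmul_add_left)

lemma zsmul_sum_right: "zsmul a (\<Sum>t\<in>T. f t) = (\<Sum>t\<in>T. zsmul a (f t))"
  by (induction T rule: infinite_finite_induct) (simp_all add: zsmul_add_right)

lemma zsmul_int: "zsmul k (m :: int) = k * m"
  by (induction k rule: int_induct[where k = 0])
    (simp_all add: zsmul_plus_1 zsmul_minus_1 algebra_simps)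

section \<open>Consequences of sharpness\<close>

lemma sharp_sum_mem:
  assumes "sharp_integral_monoid M" "\<And>t. t \<in> T \<Longrightarrow> f t \<in> M"
  shows "sum f T \<in> M"
  using assms(2)
  by (induction T rule: infinite_finite_induct)
    (use assms(1) in \<open>auto simp: sharp_integral_monoid_def\<close>)

lemma sharp_sum_eq_0D:
  assumes M: "sharp_integral_monoid M" and "finite T" "\<And>t. t \<in> T \<Longrightarrow> f t \<in> M"
    and "sum f T = 0" "t \<in> T"
  shows "f t = 0"
proof -
  have "f t + sum f (T - {t}) = 0"
    using assms by (simp add: sum.remove)
  then have "- f t = sum f (T - {t})"
    by (simp add: minus_unique)
  moreover have "sum f (T - {t}) \<in> M"
    by (rule sharp_sum_mem[OF M]) (use assms in auto)
  ultimately show ?thesis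
    using M assms by (auto simp: sharp_integral_monoid_def)
qed

lemma sharp_zsmul_mem:
  assumes "sharp_integral_monoid M" "m \<in> M" "0 \<le> k"
  shows "zsmul k m \<in> M"
  using assms(3)
  by (induction k rule: int_ge_induct)
    (use assms(1,2) in \<open>auto simp: sharp_integral_monoid_def zsmul_plus_1\<close>)

text \<open>If \<open>k > 0\<close>, then \<open>- m\<close> equals \<open>(k - 1) m\<close>, which
  lies in \<open>M\<close>; sharpness forbids this. So elements of \<open>M\<close> have infinite
  order even when the ambient group has torsion, and \<open>zquot\<close> is well defined.\<close>

lemma sharp_zsmul_eq_0D:
  assumes M: "sharp_integral_monoid M" and m: "m \<in> M" "m \<noteq> 0" and k: "zsmul k m = 0"
  shows "k = 0"
proof -
  have pos: "\<not> 0 < k" if "zsmul k m = 0" for k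
  proof
    assume "0 < k"
    have "m + zsmul (k - 1) m = 0"
      using that by (simp add: zsmul_minus_1)
    then have "- m = zsmul (k - 1) m"
      by (simp add: minus_unique)
    moreover have "zsmul (k - 1) m \<in> M"
      using M m \<open>0 < k\<close> by (simp add: sharp_zsmul_mem)
    ultimately show False
      using M m by (auto simp: sharp_integral_monoid_def)
  qed
  show ?thesis
    using pos[of k] pos[of "- k"] k by (simp add: zsmul_minus_left)
qed

lemma zquot_zsmul:
  assumes "sharp_integral_monoid M" "m \<in> M" "m \<noteq> 0"
  shows "zquot (zsmul k m) m = k"
  unfolding zquot_def
proof (rule the_equality)
  fix k' assume "zsmul k m = zsmul k' m"
  then have "zsmul (k - k') m = 0" by (simp add: zsmul_diff_left)
  then show "k' = k" using sharp_zsmul_eq_0D[OF assms, of "k - k'"] by simp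
qed simp

section \<open>Integral cones and Stiemke's alternative\<close>

inductive_set cone :: "('r \<Rightarrow> int) set \<Rightarrow> ('r \<Rightarrow> int) set" for C where
  cone_zero: "(\<lambda>_. 0) \<in> cone C"
| cone_add_gen: "v \<in> cone C \<Longrightarrow> c \<in> C \<Longrightarrow> (\<lambda>x. v x + c x) \<in> cone C"

lemma cone_add:
  assumes "u \<in> cone C" "v \<in> cone C"
  shows "(\<lambda>x. u x + v x) \<in> cone C"
  using assms(2)
proof induction
  case (cone_add_gen v c)
  then show ?case
    using cone.cone_add_gen[of "\<lambda>x. u x + v x" C c] by (simp add: add.assoc)
qed (use assms in simp)

lemma cone_scale:
  assumes "v \<in> cone C" "0 \<le> k"
  shows "(\<lambda>x. k * v x) \<in> cone C"
  using assms(2)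
proof (induction k rule: int_ge_induct)
  case base
  then show ?case by (simp add: cone_zero)
next
  case (step k)
  then show ?case using cone_add[OF step.IH assms(1)] by (simp add: algebra_simps)
qed

lemma cone_gen: "c \<in> C \<Longrightarrow> c \<in> cone C"
  using cone_add_gen[OF cone_zero, of c C] by simp

lemma cone_subset:
  assumes "C' \<subseteq> cone C" shows "cone C' \<subseteq> cone C"
proof
  fix v assume "v \<in> cone C'"
  then show "v \<in> cone C"
    by induction (use assms in \<open>auto intro: cone_zero cone_add\<close>)
qed

text \<open>Different indices may share a column, so weights belong to indices; adding a generator
  raises the weight of one index representing it.\<close>

lemma cone_image_weights:
  assumes "finite S" "v \<in> cone (col ` S)"
  shows "\<exists>u :: 'i \<Rightarrow> int. (\<forall>i. 0 \<le> u i) \<and> v = (\<lambda>x. \<Sum>i\<in>S. u i * col i x)"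
  using assms(2)
proof induction
  case cone_zero
  show ?case by (rule exI[of _ "\<lambda>_. 0"]) simp
next
  case (cone_add_gen v c)
  then obtain u i0 where u: "\<forall>i. 0 \<le> u i" "v = (\<lambda>x. \<Sum>i\<in>S. u i * col i x)"
    and i0: "i0 \<in> S" "c = col i0" by auto
  have "(\<Sum>i\<in>S. (u i + of_bool (i = i0)) * col i x) = v x + c x" for x
    using assms(1) i0 by (simp add: u(2) algebra_simps sum.distrib of_bool_def
        if_distrib[of "\<lambda>t. t * _"] if_distrib[of "\<lambda>t. _ * t"] cong: if_cong)
  then show ?case
    using u(1) by (intro exI[of _ "\<lambda>i. u i + of_bool (i = i0)"]) auto
qed

text \<open>The maximum of the fractions \<open>p c / q c\<close>, cross-multiplied to stay within
  the integers.\<close>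

lemma ratio_argmax:
  fixes p q :: "'i \<Rightarrow> int"
  assumes "finite P" "P \<noteq> {}" "\<And>c. c \<in> P \<Longrightarrow> 0 < q c"
  shows "\<exists>m\<in>P. \<forall>c\<in>P. p c * q m \<le> p m * q c"
  using assms
proof (induction P rule: finite_ne_induct)
  case (singleton x)
  then show ?case by simp
next
  case (insert x F)
  then obtain m where m: "m \<in> F" "\<forall>c\<in>F. p c * q m \<le> p m * q c" by auto
  have qx: "0 < q x" and qm: "0 < q m" using insert m by auto
  show ?case
  proof (cases "p x * q m \<le> p m * q x")
    case True
    with m show ?thesis by auto
  next
    case False
    have "p c * q x \<le> p x * q c" if c: "c \<in> F" for c
    proof -
      have "(p c * q m) * q x \<le> (p m * q c) * q x"
        using m c qx by (simp add: mult_right_mono)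
      also have "\<dots> = (p m * q x) * q c" by simp
      also have "\<dots> \<le> (p x * q m) * q c"
        using False insert.prems c by (intro mult_right_mono) (auto simp: less_imp_le)
      finally have "(p c * q x) * q m \<le> (p x * q c) * q m" by (simp add: algebra_simps)
      then show ?thesis using qm by simp
    qed
    then show ?thesis by auto
  qed
qed

text \<open>Stiemke's alternative over the integers, by eliminating one row at a time as in
Fourier--Motzkin elimination: the generators of the subcone on which the new row vanishes are
the old generators on which it vanishes and the combinations of a positive with a negative one.\<close>
theorem stiemke:
  fixes C :: "('r \<Rightarrow> int) set"
  assumes "finite R" "finite C"
    and "\<And>z. \<forall>c\<in>C. 0 \<le> (\<Sum>x\<in>R. z x * c x) \<Longrightarrow> \<forall>c\<in>C. (\<Sum>x\<in>R. z x * c x) = 0"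
  shows "\<forall>c\<in>C. \<exists>v\<in>cone C. \<forall>x\<in>R. v x + c x = 0"
  using assms
proof (induction R arbitrary: C rule: finite_induct)
  case empty
  then show ?case using cone_zero by auto
next
  case (insert p R C)
  define dot where "dot z c = (\<Sum>x\<in>R. z x * c x)" for z c :: "'r \<Rightarrow> int"
  \<comment> \<open>The hypothesis for the test vector with entry \<open>t\<close> at
    \<open>p\<close> and \<open>N * z\<close> on \<open>R\<close>; the factor \<open>N\<close>
    clears the denominator of the multiple of row \<open>p\<close> that is needed below.\<close>
  have hyp: "\<forall>c\<in>C. t * c p + N * dot z c = 0" if "\<forall>c\<in>C. 0 \<le> t * c p + N * dot z c" for t N z
  proof -
    have eq: "(\<Sum>x\<in>insert p R. (if x = p then t else N * z x) * c x) = t * c p + N * dot z c" for c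
    proof -
      have "(\<Sum>x\<in>R. (if x = p then t else N * z x) * c x) = (\<Sum>x\<in>R. N * (z x * c x))"
        using insert.hyps by (intro sum.cong) auto
      then show ?thesis
        using insert.hyps by (simp add: dot_def sum_distrib_left)
    qed
    show ?thesis
      using insert.prems(2)[of "\<lambda>x. if x = p then t else N * z x"] that unfolding eq by simp
  qed
  define P where "P = {c \<in> C. 0 < c p}"
  define Q where "Q = {c \<in> C. c p < 0}"
  define comb where "comb c d = (\<lambda>x. (- d p) * c x + c p * d x)" for c d :: "'r \<Rightarrow> int"
  define C' where "C' = {c \<in> C. c p = 0} \<union> (\<lambda>(c, d). comb c d) ` (P \<times> Q)"
  have finP: "finite P" using insert.prems by (simp add: P_def)
  have finC': "finite C'" using insert.prems by (simp add: C'_def P_def Q_def)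
  have PQ: "P = {} \<longleftrightarrow> Q = {}"
  proof
    assume "P = {}"
    then have "\<forall>c\<in>C. 0 \<le> (- 1) * c p + 0 * dot (\<lambda>_. 0) c" by (force simp: P_def)
    from hyp[OF this] show "Q = {}" by (auto simp: Q_def)
  next
    assume "Q = {}"
    then have "\<forall>c\<in>C. 0 \<le> 1 * c p + 0 * dot (\<lambda>_. 0) c" by (force simp: Q_def)
    from hyp[OF this] show "P = {}" by (auto simp: P_def)
  qed
  have dot_comb: "dot z (comb c d) = (- d p) * dot z c + c p * dot z d" for z c d
    by (simp add: dot_def comb_def sum_distrib_left algebra_simps sum.distrib sum_negf sum_subtractf)
  have "\<forall>c\<in>C'. dot z c = 0" if z: "\<forall>c\<in>C'. 0 \<le> dot z c" for z
  proof (cases "P = {}")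
    case True
    with PQ have "C' = {c \<in> C. c p = 0}" "\<forall>c\<in>C. c p = 0"
      by (auto simp: C'_def P_def Q_def) (metis linorder_neqE mem_Collect_eq empty_iff)
    then show ?thesis using hyp[of 0 1 z] z by auto
  next
    case False
    \<comment> \<open>The maximal ratio \<open>- dot z c / c p\<close> is the least multiple of row
      \<open>p\<close> that makes \<open>z\<close> nonnegative on all of \<open>P\<close>. On
      \<open>Q\<close> the resulting inequality is the nonnegativity of \<open>z\<close> on
      \<open>comb m c\<close>.\<close>
    obtain m where m: "m \<in> P" "\<forall>c\<in>P. (- dot z c) * m p \<le> (- dot z m) * c p"
      using ratio_argmax[OF finP False, of "\<lambda>c. c p" "\<lambda>c. - dot z c"] by (auto simp: P_def)
    have mp: "0 < m p" using m by (simp add: P_def)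
    have "\<forall>c\<in>C. 0 \<le> (- dot z m) * c p + m p * dot z c"
    proof
      fix c assume c: "c \<in> C"
      consider "c p = 0" | "c \<in> P" | "c \<in> Q" using c by (force simp: P_def Q_def)
      then show "0 \<le> (- dot z m) * c p + m p * dot z c"
      proof cases
        case 1
        then have "0 \<le> dot z c" using z c by (auto simp: C'_def)
        with 1 mp show ?thesis by simp
      next
        case 2
        with m(2) show ?thesis by (fastforce simp: algebra_simps)
      next
        case 3
        then have "comb m c \<in> C'" using m by (auto simp: C'_def)
        then have "0 \<le> dot z (comb m c)" using z by auto
        then show ?thesis by (simp add: dot_comb algebra_simps)
      qed
    qed
    note zero = hyp[OF this]
    show ?thesis
    proof
      fix c' assume "c' \<in> C'"
      then consider "c' \<in> C" "c' p = 0" | c d where "c \<in> C" "d \<in> C" "c' = comb c d"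
        by (auto simp: C'_def P_def Q_def)
      then show "dot z c' = 0"
      proof cases
        case 1
        with zero mp show ?thesis by auto
      next
        case 2
        \<comment> \<open>On \<open>C\<close> the values \<open>dot z\<close> are now proportional
          to the entries at \<open>p\<close>, and \<open>comb\<close> cancels those entries.\<close>
        have c: "m p * dot z c = dot z m * c p" and d: "m p * dot z d = dot z m * d p"
          using zero 2 by fastforce+
        have "m p * dot z c' = (- d p) * (m p * dot z c) + c p * (m p * dot z d)"
          by (simp add: 2 dot_comb algebra_simps)
        also have "\<dots> = 0" unfolding c d by (simp add: algebra_simps)
        finally show ?thesis using mp by simp
      qed
    qed
  qed
  then have IH: "\<forall>c\<in>C'. \<exists>v\<in>cone C'. \<forall>x\<in>R. v x + c x = 0"
    using insert.IH[OF finC'] by (simp add: dot_def)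
  have comb_cone: "comb c d \<in> cone C" if "c \<in> P" "d \<in> Q" for c d
    unfolding comb_def
    by (intro cone_add cone_scale cone_gen) (use that in \<open>auto simp: P_def Q_def\<close>)
  then have sub: "cone C' \<subseteq> cone C"
    by (intro cone_subset) (auto simp: C'_def intro: cone_gen)
  have vanish: "v p = 0" if "v \<in> cone C'" for v
    using that by induction (auto simp: C'_def comb_def)
  have neg: "\<exists>v\<in>cone C. \<forall>x\<in>insert p R. v x + c x = 0" if c: "c \<in> C'" for c
  proof -
    obtain v where v: "v \<in> cone C'" "\<forall>x\<in>R. v x + c x = 0" using IH c by blast
    have "c p = 0" using vanish[OF cone_gen[OF c]] .
    then show ?thesis using v sub vanish[OF v(1)] by (intro bexI[of _ v]) auto
  qed
  show ?case
  proof
    fix c assume c: "c \<in> C"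
    consider "c p = 0" | "c \<in> P" | "c \<in> Q" using c by (force simp: P_def Q_def)
    then show "\<exists>v\<in>cone C. \<forall>x\<in>insert p R. v x + c x = 0"
    proof cases
      case 1
      with c show ?thesis by (intro neg) (simp add: C'_def)
    next
      case 2
      then obtain d where d: "d \<in> Q" using PQ by blast
      have "comb c d \<in> C'" using 2 d by (auto simp: C'_def)
      from neg[OF this] obtain v where v: "v \<in> cone C" "\<forall>x\<in>insert p R. v x + comb c d x = 0"
        by blast
      \<comment> \<open>One copy of \<open>c\<close> is split off from \<open>comb c d\<close>; the
        remaining coefficient is nonnegative because \<open>d p\<close> is a negative
        integer.\<close>
      have "(\<lambda>x. (v x + (- d p - 1) * c x) + c p * d x) \<in> cone C"
        by (intro cone_add cone_scale cone_gen v) (use 2 d in \<open>auto simp: P_def Q_def\<close>)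
      then show ?thesis
        by (rule bexI[rotated]) (use v(2) in \<open>auto simp: comb_def algebra_simps\<close>)
    next
      case 3
      then obtain d where d: "d \<in> P" using PQ by blast
      have "comb d c \<in> C'" using 3 d by (auto simp: C'_def)
      from neg[OF this] obtain v where v: "v \<in> cone C" "\<forall>x\<in>insert p R. v x + comb d c x = 0"
        by blast
      have "(\<lambda>x. (v x + (- c p) * d x) + (d p - 1) * c x) \<in> cone C"
        by (intro cone_add cone_scale cone_gen v) (use 3 d in \<open>auto simp: P_def Q_def\<close>)
      then show ?thesis
        by (rule bexI[rotated]) (use v(2) in \<open>auto simp: comb_def algebra_simps\<close>)
    qed
  qed
qed

text \<open>A tuple \<open>(a, b, k, c)\<close> stands for the equation \<open>a - b = k c\<close>.
  A combination of the equations with nonnegative coefficients is a vanishing sum of multiples in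
  \<open>M\<close>, so by sharpness its coefficients at nonzero elements are 0: this is the
  hypothesis of \<open>stiemke\<close>. No additivity of \<open>y\<close> beyond the listed
  equations is claimed.\<close>

theorem sharp_monoid_integral_realisation:
  fixes M :: "'g::ab_group_add set" and T :: "('g \<times> 'g \<times> int \<times> 'g) set"
  assumes M: "sharp_integral_monoid M" and S: "finite S" "S \<subseteq> M" and T: "finite T"
    and rel: "\<And>a b k c. (a, b, k, c) \<in> T \<Longrightarrow>
      a \<in> S \<and> b \<in> S \<and> c \<in> S \<and> a - b = zsmul k c"
  shows "\<exists>y :: 'g \<Rightarrow> int. (\<forall>x\<in>S. x \<noteq> 0 \<longrightarrow> 0 < y x) \<and>
    (\<forall>(a, b, k, c)\<in>T. y a - y b = k * y c)"
proof -
  \<comment> \<open>The element 0 must get the value 0, and a relation \<open>q 0 = 0\<close> would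
    say nothing about \<open>q\<close>; it is no unknown.\<close>
  define S' where "S' = S - {0}"
  have finS': "finite S'" using S by (simp add: S'_def)
  \<comment> \<open>The coefficients of the unknown \<open>x\<close> in all equations; adding
    indicators allows \<open>a\<close>, \<open>b\<close> and \<open>c\<close> to coincide.\<close>
  define col :: "'g \<Rightarrow> 'g \<times> 'g \<times> int \<times> 'g \<Rightarrow> int" where "col x = (\<lambda>(a, b, k, c). of_bool (x = a) - of_bool (x = b) - k * of_bool (x = c))"
    for x
  have rel0: "(\<Sum>x\<in>S'. zsmul (col x t) x) = 0" if "t \<in> T" for t
  proof -
    obtain a b k c where t: "t = (a, b, k, c)" by (cases t)
    have pick: "(\<Sum>x\<in>S'. zsmul (of_bool (x = a)) x) = a" if "a \<in> S" for a
    proof -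
      have "(\<Sum>x\<in>S'. zsmul (of_bool (x = a)) x) = (\<Sum>x\<in>S'. if x = a then a else 0)"
        by (intro sum.cong) auto
      then show ?thesis using that finS' by (simp add: S'_def)
    qed
    have "(\<Sum>x\<in>S'. zsmul (col x t) x) = a - b - zsmul k c"
      using rel that by (simp add: t col_def zsmul_diff_left zsmul_mult sum_subtractf
          zsmul_sum_right[symmetric] pick)
    then show ?thesis using rel that t by auto
  qed
  have *: "\<forall>v\<in>col ` S'. \<exists>u\<in>cone (col ` S'). \<forall>t\<in>T. u t + v t = 0"
  proof (rule stiemke[OF T])
    show "finite (col ` S')" using finS' by simp
    fix z assume z: "\<forall>c\<in>col ` S'. 0 \<le> (\<Sum>t\<in>T. z t * c t)"
    define q where "q x = (\<Sum>t\<in>T. z t * col x t)" for x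
    have "(\<Sum>x\<in>S'. zsmul (q x) x) = (\<Sum>x\<in>S'. \<Sum>t\<in>T. zsmul (z t) (zsmul (col x t) x))"
      by (simp add: q_def zsmul_sum_left zsmul_mult)
    also have "\<dots> = (\<Sum>t\<in>T. zsmul (z t) (\<Sum>x\<in>S'. zsmul (col x t) x))"
      by (subst sum.swap) (simp add: zsmul_sum_right)
    also have "\<dots> = 0" using rel0 by simp
    finally have sum0: "(\<Sum>x\<in>S'. zsmul (q x) x) = 0" .
    have "q x = 0" if x: "x \<in> S'" for x
    proof -
      have "zsmul (q x) x = 0"
      proof (rule sharp_sum_eq_0D[OF M finS' _ sum0 x])
        fix t assume "t \<in> S'"
        then show "zsmul (q t) t \<in> M"
          using z S by (intro sharp_zsmul_mem[OF M]) (auto simp: S'_def q_def)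
      qed
      then show ?thesis
        using x S by (intro sharp_zsmul_eq_0D[OF M]) (auto simp: S'_def)
    qed
    then show "\<forall>c\<in>col ` S'. (\<Sum>t\<in>T. z t * c t) = 0" by (simp add: q_def)
  qed
  have "\<forall>x\<in>S'. \<exists>u. (\<forall>i. 0 \<le> u i) \<and> (\<forall>t\<in>T. (\<Sum>i\<in>S'. u i * col i t) + col x t = 0)"
  proof (intro ballI)
    fix x assume "x \<in> S'"
    with * obtain v where v: "v \<in> cone (col ` S')" "\<forall>t\<in>T. v t + col x t = 0" by blast
    from cone_image_weights[OF finS' v(1)] v(2)
    show "\<exists>u. (\<forall>i. 0 \<le> u i) \<and> (\<forall>t\<in>T. (\<Sum>i\<in>S'. u i * col i t) + col x t = 0)" by auto
  qed
  then obtain u where u: "\<And>x i. x \<in> S' \<Longrightarrow> (0::int) \<le> u x i"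
    "\<And>x t. x \<in> S' \<Longrightarrow> t \<in> T \<Longrightarrow> (\<Sum>i\<in>S'. u x i * col i t) + col x t = 0"
    by metis
  \<comment> \<open>Each column plus its cone combination is 0. Summing this over all columns gives
    every unknown the coefficient 1 plus nonnegative terms, hence a strictly positive
    solution.\<close>
  define y where "y i = (if i \<in> S' then (\<Sum>x\<in>S'. u x i) + 1 else 0)" for i
  have sum_y: "(\<Sum>i\<in>S'. y i * col i t) = 0" if t: "t \<in> T" for t
  proof -
    have "(\<Sum>i\<in>S'. y i * col i t) = (\<Sum>i\<in>S'. (\<Sum>x\<in>S'. u x i * col i t)) + (\<Sum>x\<in>S'. col x t)"
      by (simp add: y_def distrib_right sum.distrib sum_distrib_right)
    also have "\<dots> = (\<Sum>x\<in>S'. (\<Sum>i\<in>S'. u x i * col i t) + col x t)"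
      by (subst sum.swap) (simp add: sum.distrib)
    finally show ?thesis using u(2)[OF _ t] by simp
  qed
  have "y a - y b = k * y c" if t: "(a, b, k, c) \<in> T" for a b k c
  proof -
    have pick: "(\<Sum>i\<in>S'. y i * of_bool (i = a)) = y a" if "a \<in> S" for a
    proof -
      have "(\<Sum>i\<in>S'. y i * of_bool (i = a)) = (\<Sum>i\<in>S'. if i = a then y a else 0)"
        by (intro sum.cong) auto
      then show ?thesis using that finS' by (simp add: y_def)
    qed
    have "(\<Sum>i\<in>S'. y i * col i (a, b, k, c)) =
        (\<Sum>i\<in>S'. y i * of_bool (i = a)) - (\<Sum>i\<in>S'. y i * of_bool (i = b))
        - k * (\<Sum>i\<in>S'. y i * of_bool (i = c))"
      by (simp add: col_def right_diff_distrib sum_subtractf sum_distrib_left mult.left_commute)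
    then show ?thesis using sum_y[OF t] rel[OF t] pick by simp
  qed
  moreover have "0 < y x" if "x \<in> S" "x \<noteq> 0" for x
  proof -
    have "0 \<le> (\<Sum>z\<in>S'. u z x)" using u(1) by (rule sum_nonneg)
    then show ?thesis using that by (simp add: y_def S'_def)
  qed
  ultimately show ?thesis by blast
qed

section \<open>Rank-determining vertex sets\<close>

definition inner_hedges :: "'a set \<Rightarrow> ('a \<Rightarrow> 'a) \<Rightarrow> ('a \<Rightarrow> 'a) \<Rightarrow> 'a set \<Rightarrow> 'a set" where
  "inner_hedges X r i T = {e \<in> hedges X r. r e \<in> T \<and> r (i e) \<in> T \<and> r e \<noteq> r (i e)}"

text \<open>The bound counts half-edges, that is, edges twice: up to loops, any vertex set with at most
one point of \<open>A\<close> spans a forest.\<close>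
definition forest_at_most_one ::
  "'a set \<Rightarrow> ('a \<Rightarrow> 'a) \<Rightarrow> ('a \<Rightarrow> 'a) \<Rightarrow> 'a set \<Rightarrow> bool" where
  "forest_at_most_one X r i A \<longleftrightarrow> (\<forall>T\<subseteq>verts X r. T \<noteq> {} \<longrightarrow> card (T \<inter> A) \<le> 1 \<longrightarrow>
     card (inner_hedges X r i T) + 2 \<le> 2 * card T)"

locale fin_graph =
  fixes X :: "'a set" and r i :: "'a \<Rightarrow> 'a"
  assumes graph: "is_graph X r i"
begin

abbreviation "V \<equiv> verts X r"
abbreviation "H \<equiv> hedges X r"

lemma finite_V [simp]: "finite V" and finite_H [simp]: "finite H"
  using graph by (auto simp: is_graph_def verts_def hedges_def)

lemma finite_hedges_at [simp]: "finite (hedges_at X r v)"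
  by (rule finite_subset[OF _ finite_H]) (auto simp: hedges_at_def)

lemma V_nonempty: "V \<noteq> {}"
  using graph by (simp add: is_graph_def)

lemma hedge_ends [simp]:
  assumes "e \<in> H"
  shows "r e \<in> V" "i e \<in> H" "i (i e) = e" "i e \<noteq> e" "r (i e) \<in> V"
proof -
  have e: "e \<in> X" "r e \<noteq> e" using assms by (auto simp: verts_def hedges_def)
  with graph have *: "r e \<in> X" "r (r e) = r e" "i e \<in> X" "i (i e) = e" "i e \<noteq> e"
    by (auto simp: is_graph_def)
  with graph have "r (i e) \<in> X" "r (r (i e)) = r (i e)" "r (i e) \<noteq> i e"
    by (auto simp: is_graph_def)
  with * show "r e \<in> V" "i e \<in> H" "i (i e) = e" "i e \<noteq> e" "r (i e) \<in> V"
    by (auto simp: verts_def hedges_def)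
qed

lemma sum_hedges_at: "(\<Sum>v\<in>V. \<Sum>e\<in>hedges_at X r v. \<phi> e) = (\<Sum>e\<in>H. \<phi> e)"
  unfolding hedges_at_def by (rule sum.group) auto

lemma bij_betw_i: "bij_betw i H H"
  by (rule bij_betw_byWitness[of _ i]) auto

lemma sum_hedges_antisym:
  fixes \<phi> :: "'a \<Rightarrow> int"
  assumes "\<And>e. e \<in> H \<Longrightarrow> \<phi> (i e) = - \<phi> e"
  shows "(\<Sum>e\<in>H. \<phi> e) = 0"
proof -
  have "(\<Sum>e\<in>H. \<phi> e) = (\<Sum>e\<in>H. \<phi> (i e))"
    using sum.reindex_bij_betw[OF bij_betw_i, of \<phi>] by simp
  also have "\<dots> = - (\<Sum>e\<in>H. \<phi> e)"
    using assms by (simp add: sum_negf)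
  finally show ?thesis by simp
qed

lemma crossing_hedge:
  assumes "a \<in> V" "b \<in> V" "a \<in> S" "b \<notin> S"
  shows "\<exists>e\<in>H. r e \<in> S \<and> r (i e) \<notin> S"
proof -
  have "(a, b) \<in> (adj_rel X r i)\<^sup>*" using graph assms by (simp add: is_graph_def)
  then have "b \<notin> S \<longrightarrow> ?thesis"
    by induction (use assms in \<open>auto simp: adj_rel_def\<close>)
  with assms show ?thesis by blast
qed

abbreviation "inner \<equiv> inner_hedges X r i"

lemma finite_inner [simp]: "finite (inner T)"
  by (rule finite_subset[OF _ finite_H]) (auto simp: inner_hedges_def)

text \<open>The half-edges in \<open>F\<close> start at \<open>x\<close> and their opposites start
  in \<open>U\<close>, so all are distinct; none is inside \<open>U\<close>, as each touches
  \<open>x\<close>.\<close>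

lemma card_inner_insert:
  assumes "x \<notin> U" and F: "F \<subseteq> {e \<in> H. r e = x \<and> r (i e) \<in> U}"
  shows "card (inner U) + 2 * card F \<le> card (inner (insert x U))"
proof -
  have FH: "F \<subseteq> H" using F by auto
  then have fin: "finite F" by (rule finite_subset) simp
  have "inj_on i F" using bij_betw_i FH by (auto simp: bij_betw_def intro: inj_on_subset)
  then have "card (i ` F) = card F" by (rule card_image)
  moreover have "F \<inter> i ` F = {}"
    using assms by auto
  moreover have "inner U \<inter> (F \<union> i ` F) = {}"
    using assms by (auto simp: inner_hedges_def)
  ultimately have "card (inner U \<union> (F \<union> i ` F)) = card (inner U) + 2 * card F"
    using fin by (simp add: card_Un_disjoint)
  moreover have "card (inner U \<union> (F \<union> i ` F)) \<le> card (inner (insert x U))"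
    using assms by (intro card_mono) (auto simp: inner_hedges_def)
  ultimately show ?thesis by simp
qed

text \<open>A connected graph has at least as many edges as a spanning tree, counted twice. The set
  grows from \<open>{w}\<close>, and each new vertex brings at least one non-loop edge.\<close>

lemma card_inner_connected:
  assumes S: "finite S" "w \<in> S"
    and conn: "\<And>U. w \<in> U \<Longrightarrow> U \<subset> S \<Longrightarrow> \<exists>e\<in>H. r e \<in> U \<and> r (i e) \<in> S - U"
  shows "2 * card S \<le> card (inner S) + 2"
proof -
  have "\<exists>U. w \<in> U \<and> U \<subseteq> S \<and> card U = Suc n \<and> 2 * card U \<le> card (inner U) + 2"
    if "Suc n \<le> card S" for n
    using that
  proof (induction n)
    case 0
    show ?case using S by (intro exI[of _ "{w}"]) simp
  next
    case (Suc n)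
    then obtain U where U: "w \<in> U" "U \<subseteq> S" "card U = Suc n" "2 * card U \<le> card (inner U) + 2"
      by auto
    then have "U \<subset> S" using Suc.prems by auto
    with conn U obtain e where e: "e \<in> H" "r e \<in> U" "r (i e) \<in> S - U" by blast
    have "card (inner U) + 2 * card {i e} \<le> card (inner (insert (r (i e)) U))"
      using e by (intro card_inner_insert) auto
    moreover have "finite U" using U S finite_subset by blast
    ultimately show ?case
      using U e by (intro exI[of _ "insert (r (i e)) U"]) auto
  qed
  moreover have "0 < card S" using S by (auto simp: card_gt_0_iff)
  ultimately obtain U where "U \<subseteq> S" "card U = card S" "2 * card U \<le> card (inner U) + 2"
    by (metis Suc_pred order_refl)
  with S show ?thesis by (metis card_subset_eq)
qed

section \<open>The Laplacian for unit lengths and its maximum principle\<close>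

definition lap :: "('a \<Rightarrow> int) \<Rightarrow> 'a \<Rightarrow> int" where
  "lap f v = (\<Sum>e\<in>hedges_at X r v. f v - f (r (i e)))"

lemma lap_add: "lap (\<lambda>x. f x + g x) v = lap f v + lap g v"
  by (simp add: lap_def sum.distrib[symmetric] algebra_simps)

lemma lap_diff: "lap (\<lambda>x. f x - g x) v = lap f v - lap g v"
  by (simp add: lap_def sum_subtractf[symmetric] algebra_simps)

text \<open>The minimum keeps the value at \<open>v\<close> and can only lower the neighbours. Hence
  the minimum of two functions leading to effective divisors again leads to an effective
  one.\<close>

lemma lap_min_left: "f v \<le> g v \<Longrightarrow> lap f v \<le> lap (\<lambda>x. min (f x) (g x)) v"
  unfolding lap_def by (intro sum_mono) auto

lemma lap_min: "lap f v \<le> lap (\<lambda>x. min (f x) (g x)) v \<or> lap g v \<le> lap (\<lambda>x. min (f x) (g x)) v"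
  using lap_min_left[of f v g] lap_min_left[of g v f] by (cases "f v \<le> g v") (auto simp: min.commute)

lemma lap_nonneg_of_max:
  assumes "\<And>e. e \<in> H \<Longrightarrow> r e = v \<Longrightarrow> f (r (i e)) \<le> f v"
  shows "0 \<le> lap f v"
    and "lap f v = 0 \<Longrightarrow> e \<in> H \<Longrightarrow> r e = v \<Longrightarrow> f (r (i e)) = f v"
proof -
  show "0 \<le> lap f v"
    unfolding lap_def using assms by (intro sum_nonneg) (auto simp: hedges_at_def)
  assume "lap f v = 0" "e \<in> H" "r e = v"
  then have "f v - f (r (i e)) = 0"
    unfolding lap_def using assms
    by (subst (asm) sum_nonneg_eq_0_iff) (auto simp: hedges_at_def)
  then show "f (r (i e)) = f v" by simp
qed

lemma lap_uminus: "lap (\<lambda>x. - f x) v = - lap f v"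
  by (simp add: lap_def sum_negf[symmetric])

text \<open>A variant of Dhar's burning argument. Suppose that no effective divisor equivalent to \<open>D\<close>
has a chip at \<open>w\<close>, and choose one for which the component \<open>S\<close> of its zero set around \<open>w\<close> is as
small as possible. If some equivalent effective divisor had a chip on \<open>S\<close>, then truncating the
function leading to it at its minimum over \<open>S\<close> would move chips into \<open>S\<close> and shrink it; hence \<open>S\<close>
avoids \<open>A\<close>. Firing the complement of \<open>S\<close> would also shrink \<open>S\<close>, so it must be illegal: some
point outside \<open>S\<close> has two edges into \<open>S\<close>, which gives a cycle meeting \<open>A\<close> at most once.\<close>
theorem rank_determining:
  fixes D :: "'a \<Rightarrow> int"
  assumes A: "A \<subseteq> V" "A \<noteq> {}"
    and forest: "forest_at_most_one X r i A"
    and good: "\<And>a. a \<in> A \<Longrightarrow> \<exists>f. \<forall>v\<in>V. of_bool (v = a) \<le> D v + lap f v"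
    and w: "w \<in> V"
  shows "\<exists>f. \<forall>v\<in>V. of_bool (v = w) \<le> D v + lap f v"
proof (rule ccontr)
  assume neg: "\<not> ?thesis"
  define ch where "ch f v = D v + lap f v" for f v
  define eff where "eff f \<longleftrightarrow> (\<forall>v\<in>V. 0 \<le> ch f v)" for f
  define rel where "rel f = {(r e, r (i e)) | e. e \<in> H \<and> ch f (r e) = 0 \<and> ch f (r (i e)) = 0}" for f
  define comp where "comp f = {x. (w, x) \<in> (rel f)\<^sup>*}" for f
  have chw: "ch f w = 0" if "eff f" for f
  proof (rule ccontr)
    assume "ch f w \<noteq> 0"
    then have "of_bool (v = w) \<le> ch f v" if "v \<in> V" for v
      using bspec[OF \<open>eff f\<close>[unfolded eff_def] that] by (cases "v = w") auto
    with neg show False unfolding ch_def by blast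
  qed
  have good_eff: "\<exists>f. eff f \<and> 1 \<le> ch f a" if a: "a \<in> A" for a
  proof -
    obtain f where f: "\<forall>v\<in>V. of_bool (v = a) \<le> D v + lap f v" using good[OF a] by blast
    have "0 \<le> D v + lap f v" if "v \<in> V" for v
      using bspec[OF f that] by (cases "v = a") auto
    moreover have "1 \<le> D a + lap f a" using bspec[OF f, of a] a A by auto
    ultimately show ?thesis by (auto simp: eff_def ch_def)
  qed
  have comp_zero: "x \<in> V \<and> ch f x = 0" if "eff f" "x \<in> comp f" for f x
  proof -
    from that(2) have "(w, x) \<in> (rel f)\<^sup>*" by (simp add: comp_def)
    then show ?thesis
      by induction (use that(1) chw w in \<open>auto simp: rel_def\<close>)
  qed
  from good_eff A have "\<exists>f. eff f" by blast
  then obtain f where f: "eff f" and f_min: "\<And>f'. eff f' \<Longrightarrow> card (comp f) \<le> card (comp f')"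
    using ex_has_least_nat[of eff _ "\<lambda>f. card (comp f)"] by blast
  define S where "S = comp f"
  have wS: "w \<in> S" by (simp add: S_def comp_def)
  have SV: "S \<subseteq> V" and S0: "\<And>x. x \<in> S \<Longrightarrow> ch f x = 0"
    using comp_zero[OF f] by (auto simp: S_def)
  have finS: "finite S" by (rule finite_subset[OF SV finite_V])
  have S_bdry: "1 \<le> ch f (r (i e))" if "e \<in> H" "r e \<in> S" "r (i e) \<notin> S" for e
  proof (rule ccontr)
    assume "\<not> ?thesis"
    then have "ch f (r (i e)) = 0"
      using bspec[OF f[unfolded eff_def], of "r (i e)"] that(1) by simp
    then have "(r e, r (i e)) \<in> rel f" using that S0 by (auto simp: rel_def)
    then have "r (i e) \<in> S" using that(2) by (auto simp: S_def comp_def intro: rtrancl_into_rtrancl)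
    with that show False by simp
  qed
  \<comment> \<open>By \<open>sep\<close> no path of zeros starting in \<open>S\<close> leaves
    \<open>S\<close>, so the new component lies in \<open>S\<close> and misses \<open>x\<close>,
    against minimality.\<close>
  have shrink: False if f': "eff f'" and x: "x \<in> S" "ch f' x \<noteq> 0"
    and sep: "\<And>e. e \<in> H \<Longrightarrow> r e \<in> S \<Longrightarrow> r (i e) \<notin> S \<Longrightarrow> ch f' (r e) = 0 \<Longrightarrow> ch f' (r (i e)) \<noteq> 0" for f' x
  proof -
    have "y \<in> S" if "y \<in> comp f'" for y
    proof -
      from that have "(w, y) \<in> (rel f')\<^sup>*" by (simp add: comp_def)
      then show ?thesis by induction (use wS sep in \<open>auto simp: rel_def\<close>)
    qed
    then have "comp f' \<subset> S" using comp_zero[OF f'] x by blast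
    then have "card (comp f') < card S" using finS by (simp add: psubset_card_mono)
    with f_min[OF f'] show False by (simp add: S_def)
  qed
  have S_conn: "P y" if "x \<in> S" "P x" "y \<in> S"
    and step: "\<And>e. e \<in> H \<Longrightarrow> r e \<in> S \<Longrightarrow> r (i e) \<in> S \<Longrightarrow> P (r e) \<Longrightarrow> P (r (i e))" for P x y
  proof -
    have "sym (rel f)"
    proof (rule symI)
      fix a b assume "(a, b) \<in> rel f"
      then obtain e where "e \<in> H" "a = r e" "b = r (i e)" "ch f a = 0" "ch f b = 0"
        by (auto simp: rel_def)
      then show "(b, a) \<in> rel f" unfolding rel_def by (auto intro!: exI[of _ "i e"])
    qed
    then have "(x, w) \<in> (rel f)\<^sup>*" using that(1) by (auto simp: S_def comp_def dest: sym_rtrancl symD)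
    then have "(x, y) \<in> (rel f)\<^sup>*" using that(3) by (auto simp: S_def comp_def)
    then have "P y \<and> y \<in> S"
    proof induction
      case (step y z)
      then have "z \<in> S" by (auto simp: S_def comp_def intro: rtrancl_into_rtrancl)
      with step that(4) show ?case by (auto simp: rel_def)
    qed (use that in auto)
    then show ?thesis by simp
  qed
  have "S \<inter> A = {}"
  proof (rule ccontr)
    assume "S \<inter> A \<noteq> {}"
    then obtain a where a: "a \<in> S" "a \<in> A" by blast
    then obtain f2 where f2: "eff f2" "1 \<le> ch f2 a" using good_eff by blast
    define k where "k x = f2 x - f x" for x
    define c where "c = Min (k ` S)"
    have c_le: "c \<le> k x" if "x \<in> S" for x using that finS by (simp add: c_def)
    have "c \<in> k ` S" unfolding c_def using finS wS by (intro Min_in) auto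
    then obtain x0 where x0: "x0 \<in> S" "k x0 = c" by auto
    have ch2: "ch f2 x = ch f x + lap k x" for x by (simp add: ch_def k_def[abs_def] lap_diff)
    \<comment> \<open>Since \<open>c\<close> is the minimum over \<open>S\<close> only,
      \<open>h\<close> is 0 on \<open>S\<close> and may be negative outside; \<open>f'\<close> is
      the minimum of \<open>f\<close> and the shifted \<open>f2\<close>, hence effective.\<close>
    define h where "h x = min (k x - c) 0" for x
    define f' where "f' x = f x + h x" for x
    have chf': "ch f' x = ch f x + lap h x" for x by (simp add: ch_def f'_def[abs_def] lap_add)
    have f'_min: "f' = (\<lambda>x. min (f2 x - c) (f x))" by (auto simp: f'_def h_def k_def)
    have "lap (\<lambda>x. f2 x - c) v = lap f2 v" for v by (simp add: lap_def)
    then have eff': "eff f'"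
      unfolding eff_def
    proof (intro ballI)
      fix v assume v: "v \<in> V"
      then have "0 \<le> ch f v" "0 \<le> ch f2 v" using f f2 by (auto simp: eff_def)
      with lap_min[of "\<lambda>x. f2 x - c" v f] \<open>lap (\<lambda>x. f2 x - c) v = lap f2 v\<close>
      show "0 \<le> ch f' v" unfolding f'_min ch_def by linarith
    qed
    have hS: "h x = 0" if "x \<in> S" for x using c_le[OF that] by (simp add: h_def)
    have h_le: "h x \<le> 0" for x by (simp add: h_def)
    have lap_h: "0 \<le> lap h x" "\<And>e. lap h x = 0 \<Longrightarrow> e \<in> H \<Longrightarrow> r e = x \<Longrightarrow> h (r (i e)) = 0"
      if "h x = 0" for x
      using lap_nonneg_of_max[of x h] h_le that by auto
    \<comment> \<open>A chip arriving in \<open>S\<close> would allow \<open>shrink\<close>: across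
      a boundary edge whose inner end stays empty, \<open>h\<close> is 0 at the outer end, a
      maximum, so the chip given there by \<open>S_bdry\<close> is not lost.\<close>
    have still: "ch f' x = 0" if x: "x \<in> S" for x
    proof (rule ccontr)
      assume "ch f' x \<noteq> 0"
      then show False
      proof (rule shrink[OF eff' x])
        fix e assume e: "e \<in> H" "r e \<in> S" "r (i e) \<notin> S" "ch f' (r e) = 0"
        then have "lap h (r e) = 0" using chf' S0 by simp
        then have "h (r (i e)) = 0" using lap_h(2)[OF hS] e by auto
        then show "ch f' (r (i e)) \<noteq> 0"
          using lap_h(1) S_bdry[OF e(1-3)] chf' by (metis add_increasing2 not_one_le_zero)
      qed
    qed
    have nbr: "c \<le> k (r (i e))" if "e \<in> H" "r e \<in> S" for e
    proof -
      have "lap h (r e) = 0" using still that S0 chf' by simp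
      then have "h (r (i e)) = 0" using lap_h(2)[OF hS] that by auto
      then show ?thesis by (simp add: h_def min_def split: if_splits)
    qed
    have lap_k: "lap k x \<le> 0" "\<And>e. lap k x = 0 \<Longrightarrow> e \<in> H \<Longrightarrow> r e = x \<Longrightarrow> k (r (i e)) = c"
      if "x \<in> S" "k x = c" for x
      using lap_nonneg_of_max[of x "\<lambda>x. - k x"] nbr that by (auto simp: lap_uminus)
    \<comment> \<open>Where \<open>k = c\<close>, \<open>nbr\<close> makes the point a local minimum
      of \<open>k\<close>, while effectivity of \<open>f2\<close> forces \<open>lap k\<close> to be
      nonnegative. So \<open>lap k\<close> is 0 and the value \<open>c\<close> spreads through
      \<open>S\<close> to \<open>a\<close>, where no chip can then arrive.\<close>
    have kc: "k a = c"
    proof (rule S_conn[where P = "\<lambda>x. k x = c", OF x0(1) x0(2) a(1)])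
      fix e assume e: "e \<in> H" "r e \<in> S" "r (i e) \<in> S" "k (r e) = c"
      have "0 \<le> ch f2 (r e)" using f2 e SV by (auto simp: eff_def)
      then have "lap k (r e) = 0" using lap_k(1) e S0 ch2 by force
      then show "k (r (i e)) = c" using lap_k(2) e by blast
    qed
    show False using lap_k(1)[OF a(1) kc] f2(2) S0[OF a(1)] ch2[of a] by simp
  qed
  then obtain b where b: "b \<in> V" "b \<notin> S" using A by blast
  \<comment> \<open>Adding the indicator of \<open>S\<close> fires the complement: one chip moves
    into \<open>S\<close> along each boundary edge.\<close>
  define f' where "f' x = f x + of_bool (x \<in> S)" for x
  have chf': "ch f' x = ch f x + lap (\<lambda>x. of_bool (x \<in> S)) x" for x
    by (simp add: ch_def f'_def[abs_def] lap_add)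
  define into where "into y = {e \<in> H. r e = y \<and> r (i e) \<in> S}" for y
  have lap_S: "lap (\<lambda>x. of_bool (x \<in> S)) x = - int (card (into x))" if "x \<notin> S" for x
  proof -
    have "into x = {e \<in> hedges_at X r x. r (i e) \<in> S}" by (auto simp: into_def hedges_at_def)
    then show ?thesis
      using that by (simp add: lap_def sum_negf of_bool_def sum.If_cases Int_def)
  qed
  have bdry_pos: "0 < ch f' (r e)" if "e \<in> H" "r e \<in> S" "r (i e) \<notin> S" for e
  proof -
    have "lap (\<lambda>x. of_bool (x \<in> S)) (r e) \<noteq> 0"
      using lap_nonneg_of_max(2)[of "r e" "\<lambda>x. of_bool (x \<in> S)" e] that by auto
    then show ?thesis
      using lap_nonneg_of_max(1)[of "r e" "\<lambda>x. of_bool (x \<in> S)"] that S0 chf' by fastforce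
  qed
  have "\<not> eff f'"
  proof
    assume "eff f'"
    obtain e where "e \<in> H" "r e \<in> S" "r (i e) \<notin> S"
      using crossing_hedge[OF w b(1) wS b(2)] by blast
    with shrink[OF \<open>eff f'\<close>, of "r e"] bdry_pos show False by force
  qed
  then obtain y where y: "y \<in> V" "ch f' y < 0" by (auto simp: eff_def)
  have yS: "y \<notin> S"
  proof
    assume "y \<in> S"
    then have "0 \<le> lap (\<lambda>x. of_bool (x \<in> S)) y" by (intro lap_nonneg_of_max(1)) auto
    with y \<open>y \<in> S\<close> S0 chf' show False by simp
  qed
  \<comment> \<open>\<open>y\<close> cannot pay for its edges into \<open>S\<close>; being next to
    \<open>S\<close> it owns a chip, so there are at least two such edges.\<close>
  have card_into: "ch f y < int (card (into y))" using y lap_S[OF yS] chf' by simp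
  moreover have "0 \<le> ch f y" using f y by (simp add: eff_def)
  ultimately have "into y \<noteq> {}" by (auto simp: card_gt_0_iff)
  then obtain e where "e \<in> H" "r e = y" "r (i e) \<in> S" by (auto simp: into_def)
  with S_bdry[of "i e"] yS have "1 \<le> ch f y" by auto
  with card_into have two: "2 \<le> card (into y)" by simp
  have "2 * card S \<le> card (inner S) + 2"
  proof (rule card_inner_connected[OF finS wS])
    fix U assume U: "w \<in> U" "U \<subset> S"
    show "\<exists>e\<in>H. r e \<in> U \<and> r (i e) \<in> S - U"
    proof (rule ccontr)
      assume no: "\<not> ?thesis"
      obtain x where x: "x \<in> S" "x \<notin> U" using U by blast
      have "x \<in> U" by (rule S_conn[where P = "\<lambda>x. x \<in> U", OF wS _ x(1)]) (use U no in auto)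
      with x show False by simp
    qed
  qed
  moreover have "card (inner S) + 2 * card (into y) \<le> card (inner (insert y S))"
    using yS by (intro card_inner_insert) (auto simp: into_def)
  moreover have "card (inner (insert y S)) + 2 \<le> 2 * card (insert y S)"
  proof (rule forest[unfolded forest_at_most_one_def, rule_format])
    have "insert y S \<inter> A \<subseteq> {y}" using \<open>S \<inter> A = {}\<close> by auto
    from card_mono[OF _ this] show "card (insert y S \<inter> A) \<le> 1" by simp
  qed (use y SV in auto)
  \<comment> \<open>There are at least \<open>2 * card S - 2 + 4\<close> half-edges, but the forest
    bound allows only \<open>2 * (card S + 1) - 2\<close>.\<close>
  ultimately show False using two yS finS by simp
qed

end

section \<open>Divisors of rank at least one\<close>

locale m_graph = fin_graph X r i
  for X :: "'a set" and r i :: "'a \<Rightarrow> 'a" +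
  fixes M :: "'g::ab_group_add set" and l :: "'a \<Rightarrow> 'g"
  assumes sharp: "sharp_integral_monoid M"
    and metrised: "metrised_graph M X r i l"
begin

lemma length_hedge: "e \<in> H \<Longrightarrow> l e \<in> M \<and> l e \<noteq> 0 \<and> l (i e) = l e"
  using metrised by (auto simp: metrised_graph_def hedges_def)

definition slope :: "('a \<Rightarrow> 'g) \<Rightarrow> 'a \<Rightarrow> int" where
  "slope g e = zquot (g (r e) - g (r (i e))) (l e)"

lemma slope_eqI:
  assumes "e \<in> H" "g (r e) - g (r (i e)) = zsmul k (l e)"
  shows "slope g e = k"
  using assms length_hedge zquot_zsmul[OF sharp] by (simp add: slope_def)

lemma zsmul_slope:
  assumes "g \<in> PL M X r i l" "e \<in> H"
  shows "g (r e) - g (r (i e)) = zsmul (slope g e) (l e)"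
proof -
  obtain k where "g (r e) - g (r (i e)) = zsmul k (l e)"
    using assms by (auto simp: PL_def zspan_def)
  with slope_eqI[OF assms(2) this] show ?thesis by simp
qed

lemma Laplacian_slope:
  "v \<in> V \<Longrightarrow> Laplacian X r i l g v = (\<Sum>e\<in>hedges_at X r v. slope g e)"
  by (auto simp: Laplacian_def slope_def hedges_at_def intro!: sum.cong)

text \<open>The sum over all vertices meets each half-edge once, and the slopes of the two halves of
  an edge cancel.\<close>

lemma deg_Laplacian:
  assumes g: "g \<in> PL M X r i l"
  shows "deg X r (Laplacian X r i l g) = 0"
proof -
  have "slope g (i e) = - slope g e" if e: "e \<in> H" for e
  proof (rule slope_eqI)
    have "g (r (i e)) - g (r e) = - zsmul (slope g e) (l e)"
      using zsmul_slope[OF g e] by (metis minus_diff_eq)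
    then show "g (r (i e)) - g (r (i (i e))) = zsmul (- slope g e) (l (i e))"
      using e length_hedge by (simp add: zsmul_minus_left)
  qed (use e in simp)
  then have "(\<Sum>e\<in>H. slope g e) = 0" by (rule sum_hedges_antisym)
  then show ?thesis by (simp add: deg_def Laplacian_slope sum_hedges_at)
qed

text \<open>\<open>Max\<close> is meaningful only for a finite set, and the degree of
  \<open>D\<close> bounds the admissible \<open>k\<close>. Forwards, \<open>Max K\<close> chips on
  one vertex are at least one chip; backwards, an effective divisor of degree 1 is a single
  vertex.\<close>

lemma rank_ge_1_iff:
  assumes D: "divisor X r D"
  shows "1 \<le> rank M X r i l D \<longleftrightarrow>
    (\<forall>v\<in>V. \<exists>g\<in>PL M X r i l. \<forall>u\<in>V. of_bool (u = v) \<le> D u + Laplacian X r i l g u)"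
    (is "_ \<longleftrightarrow> ?good")
proof -
  define K where "K = {k::nat. \<forall>F. divisor X r F \<and> effective F \<and> deg X r F = int k \<longrightarrow>
    lin_sys M X r i l (\<lambda>v. D v - F v) \<noteq> {}}"
  have rank: "rank M X r i l D = (if K = {} then - 1 else int (Max K))"
    unfolding rank_def K_def Let_def by (rule HOL.refl)
  have winning: "\<exists>g\<in>PL M X r i l. \<forall>u. (if u = v then int k else 0) \<le> D u + Laplacian X r i l g u"
    if k: "k \<in> K" and v: "v \<in> V" for k v
  proof -
    define F where "F = (\<lambda>u. if u = v then int k else 0)"
    have "divisor X r F" "effective F" using v by (auto simp: F_def divisor_def effective_def)
    moreover have "deg X r F = int k" using v by (simp add: deg_def F_def)
    ultimately obtain E where "E \<in> lin_sys M X r i l (\<lambda>v. D v - F v)"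
      using k by (auto simp: K_def)
    then obtain g where g: "g \<in> PL M X r i l" "\<And>u. 0 \<le> E u"
      "\<And>u. E u - (D u - F u) = Laplacian X r i l g u"
      by (auto simp: lin_sys_def lin_equiv_def effective_def)
    have "F u \<le> D u + Laplacian X r i l g u" for u using g(2)[of u] g(3)[of u] by simp
    with g(1) show ?thesis unfolding F_def by blast
  qed
  obtain v0 where v0: "v0 \<in> V" using V_nonempty by blast
  have "k \<le> nat (deg X r D)" if k: "k \<in> K" for k
  proof -
    obtain g where g: "g \<in> PL M X r i l"
      "\<forall>u. (if u = v0 then int k else 0) \<le> D u + Laplacian X r i l g u"
      using winning[OF k v0] by blast
    have "int k = (\<Sum>u\<in>V. if u = v0 then int k else 0)" using v0 by simp
    also have "\<dots> \<le> (\<Sum>u\<in>V. D u + Laplacian X r i l g u)" using g(2) by (intro sum_mono) blast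
    also have "\<dots> = deg X r D" using deg_Laplacian[OF g(1)] by (simp add: deg_def sum.distrib)
    finally show ?thesis by simp
  qed
  then have finK: "finite K" by (meson finite_nat_set_iff_bounded_le)
  show ?thesis
  proof
    assume "1 \<le> rank M X r i l D"
    then have "K \<noteq> {}" "1 \<le> Max K" by (auto simp: rank split: if_splits)
    then have MaxK: "Max K \<in> K" using finK by simp
    show ?good
    proof
      fix v assume v: "v \<in> V"
      obtain g where g: "g \<in> PL M X r i l"
        "\<And>u. (if u = v then int (Max K) else 0) \<le> D u + Laplacian X r i l g u"
        using winning[OF MaxK v] by blast
      have "of_bool (u = v) \<le> D u + Laplacian X r i l g u" for u
        using g(2)[of u] \<open>1 \<le> Max K\<close> by (auto split: if_splits)
      with g(1) show "\<exists>g\<in>PL M X r i l. \<forall>u\<in>V. of_bool (u = v) \<le> D u + Laplacian X r i l g u"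
        by blast
    qed
  next
    assume good: ?good
    have "1 \<in> K"
      unfolding K_def mem_Collect_eq
    proof (intro allI impI)
      fix F assume F: "divisor X r F \<and> effective F \<and> deg X r F = int 1"
      then have F0: "\<And>u. 0 \<le> F u" and sum1: "(\<Sum>u\<in>V. F u) = 1"
        by (auto simp: effective_def deg_def)
      have "\<exists>v\<in>V. F v \<noteq> 0" using sum1 by (metis sum.neutral zero_neq_one)
      then obtain v where v: "v \<in> V" "1 \<le> F v" using F0 by (metis linorder_not_less int_one_le_iff_zero_less order_le_less)
      have rest: "F v + (\<Sum>u\<in>V - {v}. F u) = 1" using sum1 v by (simp add: sum.remove)
      have "0 \<le> (\<Sum>u\<in>V - {v}. F u)" using F0 by (simp add: sum_nonneg)
      with rest v have Fv: "F v = 1" "(\<Sum>u\<in>V - {v}. F u) = 0" by auto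
      then have "\<forall>u\<in>V - {v}. F u = 0" using F0 by (subst (asm) sum_nonneg_eq_0_iff) auto
      with Fv F v have F_eq: "F u = of_bool (u = v)" for u
        by (cases "u \<in> V") (auto simp: divisor_def)
      obtain g where g: "g \<in> PL M X r i l"
        "\<And>u. u \<in> V \<Longrightarrow> of_bool (u = v) \<le> D u + Laplacian X r i l g u"
        using good v by blast
      define E where "E u = D u - F u + Laplacian X r i l g u" for u
      have off: "E u = 0" if "u \<notin> V" for u
        using that D F by (simp add: E_def divisor_def Laplacian_def)
      have "0 \<le> E u" for u
        using g(2)[of u] off[of u] F_eq[of u] by (cases "u \<in> V") (auto simp: E_def)
      then have "E \<in> lin_sys M X r i l (\<lambda>v. D v - F v)"
        using off g(1) by (auto simp: lin_sys_def divisor_def effective_def lin_equiv_def E_def)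
      then show "lin_sys M X r i l (\<lambda>v. D v - F v) \<noteq> {}" by blast
    qed
    then show "1 \<le> rank M X r i l D"
      using finK Max_ge[OF finK, of 1] by (auto simp: rank)
  qed
qed

text \<open>The \<open>LEAST\<close> in \<open>dgon\<close> needs some admissible degree: one chip
  on every vertex wins without any move.\<close>

lemma dgon_attained:
  obtains D where "divisor X r D" "deg X r D = int (dgon M X r i l)" "1 \<le> rank M X r i l D"
proof -
  define D where "D v = (of_bool (v \<in> V) :: int)" for v
  have D: "divisor X r D" by (simp add: D_def divisor_def)
  have "zsmul 0 (l e) \<in> zspan (l e)" for e unfolding zspan_def by blast
  then have "(\<lambda>_. 0) \<in> PL M X r i l"
    using sharp by (force simp: PL_def Mgp_def sharp_integral_monoid_def)
  moreover have "Laplacian X r i l (\<lambda>_. 0) u = 0" if "u \<in> V" for u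
    using that by (auto simp: Laplacian_slope hedges_at_def intro!: sum.neutral slope_eqI)
  ultimately have "1 \<le> rank M X r i l D"
    by (auto simp: rank_ge_1_iff[OF D] D_def intro!: bexI[of _ "\<lambda>_. 0"])
  moreover have "deg X r D = int (card V)" by (simp add: deg_def D_def)
  ultimately have "\<exists>n D. divisor X r D \<and> deg X r D = int n \<and> 1 \<le> rank M X r i l D"
    using D by blast
  from LeastI_ex[OF this] show thesis using that unfolding dgon_def by blast
qed

end

section \<open>Subdividing an edge\<close>

text \<open>Loops get length one, so that they are never subdivided.\<close>
definition int_graph ::
  "'a set \<Rightarrow> ('a \<Rightarrow> 'a) \<Rightarrow> ('a \<Rightarrow> 'a) \<Rightarrow> ('a \<Rightarrow> int) \<Rightarrow> bool" where
  "int_graph X r i l \<longleftrightarrow> is_graph X r i \<and>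
    (\<forall>e\<in>hedges X r. 1 \<le> l e \<and> l (i e) = l e \<and> (r e = r (i e) \<longrightarrow> l e = 1))"

text \<open>Slopes are a separate witness \<open>\<sigma>\<close>, so no division occurs and
  subdividing can leave the old slopes untouched.\<close>

definition wins_at ::
  "'a set \<Rightarrow> ('a \<Rightarrow> 'a) \<Rightarrow> ('a \<Rightarrow> 'a) \<Rightarrow> ('a \<Rightarrow> int) \<Rightarrow> ('a \<Rightarrow> int) \<Rightarrow> 'a \<Rightarrow> bool" where
  "wins_at X r i l D a \<longleftrightarrow> (\<exists>g \<sigma>.
    (\<forall>e\<in>hedges X r. g (r e) - g (r (i e)) = \<sigma> e * l e) \<and>
    (\<forall>v\<in>verts X r. of_bool (v = a) \<le> D v + (\<Sum>e\<in>hedges_at X r v. \<sigma> e)))"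

locale edge_split = fin_graph X r i
  for X :: "'a set" and r i :: "'a \<Rightarrow> 'a" +
  fixes l :: "'a \<Rightarrow> int" and e w f f' :: 'a
  assumes int_graph: "int_graph X r i l"
    and e: "e \<in> H" and long: "2 \<le> l e"
    and fresh: "w \<notin> X" "f \<notin> X" "f' \<notin> X" "distinct [w, f, f']"
begin

definition "Z = X \<union> {w, f, f'}"
definition "t = r(w := w, f := w, f' := w)"
definition "k = i(e := f, i e := f', w := w, f := e, f' := i e)"
text \<open>A unit piece is cut off at the end \<open>r e\<close>; the rest keeps positive length
  because of \<open>long\<close>.\<close>

definition "m = l(e := 1, f := 1, i e := l e - 1, f' := l e - 1)"

lemma lengths:
  "x \<in> H \<Longrightarrow> 1 \<le> l x" "x \<in> H \<Longrightarrow> l (i x) = l x" "x \<in> H \<Longrightarrow> r x = r (i x) \<Longrightarrow> l x = 1"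
  using int_graph by (auto simp: int_graph_def)

lemma nonloop: "r e \<noteq> r (i e)"
  using lengths(3)[OF e] long by auto

lemma HX: "x \<in> H \<Longrightarrow> x \<in> X" and VX: "x \<in> V \<Longrightarrow> x \<in> X"
  by (auto simp: hedges_def verts_def)

lemma V_or_H: "x \<in> X \<Longrightarrow> x \<in> V \<or> x \<in> H"
  by (auto simp: hedges_def)

lemma new_neq [simp]:
  "x \<in> X \<Longrightarrow> x \<noteq> w" "x \<in> X \<Longrightarrow> x \<noteq> f" "x \<in> X \<Longrightarrow> x \<noteq> f'" "x \<in> X \<Longrightarrow> w \<noteq> x"
  "x \<in> X \<Longrightarrow> f \<noteq> x" "x \<in> X \<Longrightarrow> f' \<noteq> x"
  "f \<noteq> w" "f' \<noteq> w" "f \<noteq> f'" "w \<noteq> f" "w \<noteq> f'" "f' \<noteq> f"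
  using fresh by auto

lemma w_notin_V [simp]: "w \<notin> V"
  using VX fresh by blast

lemma eX [simp]: "e \<in> X" "i e \<in> X" "i e \<noteq> e" "e \<noteq> i e" "i (i e) = e"
  "i e \<in> H" "r e \<in> V" "r (i e) \<in> V" "r e \<in> X" "r (i e) \<in> X"
  using HX[OF e] HX[of "i e"] VX[of "r e"] VX[of "r (i e)"] hedge_ends[OF e] by metis+

lemma t_simps [simp]: "x \<in> X \<Longrightarrow> t x = r x" "t w = w" "t f = w" "t f' = w"
  by (auto simp: t_def)

lemma k_simps [simp]: "k e = f" "k f = e" "k (i e) = f'" "k f' = i e" "k w = w"
  "x \<in> X \<Longrightarrow> x \<noteq> e \<Longrightarrow> x \<noteq> i e \<Longrightarrow> k x = i x"
  using new_neq(1-3)[of e] new_neq(1-3)[of "i e"] new_neq(1-3)[of x] by (auto simp: k_def simp del: new_neq(1-3))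

lemma m_simps [simp]: "m e = 1" "m f = 1" "m (i e) = l e - 1" "m f' = l e - 1"
  "x \<in> X \<Longrightarrow> x \<noteq> e \<Longrightarrow> x \<noteq> i e \<Longrightarrow> m x = l x"
  using new_neq(1-3)[of e] new_neq(1-3)[of "i e"] new_neq(1-3)[of x] by (auto simp: m_def simp del: new_neq(1-3))

lemma verts_Z: "verts Z t = insert w V"
  by (auto simp: verts_def Z_def)

lemma hedges_Z: "hedges Z t = H \<union> {f, f'}"
  unfolding hedges_def verts_Z using VX fresh by (auto simp: Z_def hedges_def)

lemma hedges_at_Z: "v \<in> V \<Longrightarrow> hedges_at Z t v = hedges_at X r v"
  and hedges_at_w: "hedges_at Z t w = {f, f'}"
proof -
  have "r x \<noteq> w" if "x \<in> H" for x using that VX[of "r x"] by auto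
  then show "hedges_at Z t w = {f, f'}"
    using HX by (auto simp: hedges_at_def hedges_Z)
  assume "v \<in> V"
  then have "v \<noteq> w" using VX by auto
  then show "hedges_at Z t v = hedges_at X r v"
    using HX by (auto simp: hedges_at_def hedges_Z)
qed

lemma old_hedge:
  assumes "x \<in> H" "x \<noteq> e" "x \<noteq> i e"
  shows "k x = i x" "t x = r x" "t (i x) = r (i x)" "m x = l x" "i x \<noteq> e" "i x \<noteq> i e" "i x \<in> X"
  using assms HX[of x] HX[of "i x"] hedge_ends[of x] e by auto (metis eX(5) hedge_ends(3))+

lemma hedges_Z_cases:
  assumes "x \<in> hedges Z t"
  obtains "x \<in> H" "x \<noteq> e" "x \<noteq> i e" | "x = e" | "x = i e" | "x = f" | "x = f'"
  using assms by (auto simp: hedges_Z)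

lemma graph_Z: "is_graph Z t k"
  unfolding is_graph_def
proof (intro conjI ballI)
  show "finite Z" using graph by (simp add: Z_def is_graph_def)
  show "verts Z t \<noteq> {}" by (simp add: verts_Z)
next
  fix x assume "x \<in> Z"
  then consider "x \<in> V \<or> x = w" | "x \<in> hedges Z t" unfolding hedges_Z by (auto simp: Z_def dest: V_or_H)
  then have "t x \<in> Z \<and> t (t x) = t x \<and> k x \<in> Z \<and> k (k x) = x \<and> (k x = x \<longleftrightarrow> t x = x)"
  proof cases
    case 1
    from 1 show ?thesis
    proof
      assume x: "x \<in> V"
      then have "x \<in> X" "r x = x" by (auto simp: verts_def)
      moreover from this have "i x = x" using graph by (simp add: is_graph_def)
      moreover have "x \<noteq> e" "x \<noteq> i e" using x e eX(6) by (auto simp: hedges_def)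
      ultimately show ?thesis by (simp add: Z_def)
    qed (simp add: Z_def)
  next
    case 2
    then show ?thesis
    proof (cases rule: hedges_Z_cases)
      case 1
      have "r x \<in> X" "r (r x) = r x" using hedge_ends(1)[OF 1(1)] by (simp_all add: verts_def)
      moreover have "x \<in> X" "r x \<noteq> x" using 1(1) by (simp_all add: hedges_def verts_def)
      moreover have "k (i x) = x"
        using old_hedge[OF 1] hedge_ends[OF 1(1)] k_simps(6)[of "i x"] by simp
      ultimately show ?thesis
        using old_hedge[OF 1] hedge_ends[OF 1(1)] by (simp add: Z_def)
    next
      case 2
      have "r e \<noteq> e" "r (r e) = r e" using e eX(7) by (simp_all add: hedges_def verts_def)
      with 2 show ?thesis by (simp add: Z_def)
    next
      case 3
      have "r (i e) \<noteq> i e" "r (r (i e)) = r (i e)"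
        using eX(6,8) by (simp_all add: hedges_def verts_def)
      with 3 show ?thesis by (simp add: Z_def)
    qed (simp_all add: Z_def)
  qed
  then show "t x \<in> Z" "t (t x) = t x" "k x \<in> Z" "k (k x) = x" "k x = x \<longleftrightarrow> t x = x" by blast+
next
  let ?R = "adj_rel Z t k"
  have adj: "(t x, t (k x)) \<in> ?R" if "x \<in> hedges Z t" for x
    using that by (auto simp: adj_rel_def)
  have new: "(r e, w) \<in> ?R" "(w, r e) \<in> ?R" "(r (i e), w) \<in> ?R" "(w, r (i e)) \<in> ?R"
    using adj[of e] adj[of f] adj[of "i e"] adj[of f'] e by (auto simp: hedges_Z)
  have "adj_rel X r i \<subseteq> ?R\<^sup>*"
  proof
    fix p assume "p \<in> adj_rel X r i"
    then obtain x where x: "x \<in> H" "p = (r x, r (i x))" by (auto simp: adj_rel_def)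
    then consider "x \<noteq> e" "x \<noteq> i e" | "x = e" | "x = i e" by blast
    then show "p \<in> ?R\<^sup>*"
    proof cases
      case 1
      then show ?thesis using adj[of x] old_hedge[of x] x by (auto simp: hedges_Z)
    next
      case 2
      then show ?thesis using x new by (auto intro: rtrancl_trans)
    next
      case 3
      then show ?thesis using x new by (auto intro: rtrancl_trans)
    qed
  qed
  then have "(adj_rel X r i)\<^sup>* \<subseteq> ?R\<^sup>*" by (rule rtrancl_subset_rtrancl)
  moreover have "\<forall>a\<in>V. \<forall>b\<in>V. (a, b) \<in> (adj_rel X r i)\<^sup>*" using graph by (simp add: is_graph_def)
  ultimately have old: "(a, b) \<in> ?R\<^sup>*" if "a \<in> V" "b \<in> V" for a b
    using that by blast
  have to_e: "(a, r e) \<in> ?R\<^sup>*" "(r e, a) \<in> ?R\<^sup>*" if "a \<in> verts Z t" for a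
    using that old[of a "r e"] old[of "r e" a] new by (auto simp: verts_Z)
  fix u v assume "u \<in> verts Z t" "v \<in> verts Z t"
  with to_e show "(u, v) \<in> ?R\<^sup>*" by (meson rtrancl_trans)
qed

lemma subdivision_step_Z: "subdivision_step X r i Z t k"
  unfolding subdivision_step_def
  by (rule exI[of _ e], rule exI[of _ w], rule exI[of _ f], rule exI[of _ f'])
    (use e fresh in \<open>auto simp: Z_def\<close>)

lemma int_graph_Z: "int_graph Z t k m"
  unfolding int_graph_def
proof (intro conjI ballI graph_Z)
  fix x assume "x \<in> hedges Z t"
  then have "1 \<le> m x \<and> m (k x) = m x \<and> (t x = t (k x) \<longrightarrow> m x = 1)"
  proof (cases rule: hedges_Z_cases)
    case 1
    then show ?thesis using old_hedge[OF 1] lengths[of x] by auto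
  qed (use long in auto)
  then show "1 \<le> m x" "m (k x) = m x" "t x = t (k x) \<longrightarrow> m x = 1" by blast+
qed

text \<open>Linear interpolation: the two slopes leaving \<open>w\<close> are opposite, so no chip
  moves at \<open>w\<close>, and the slopes at old vertices stay.\<close>

lemma wins_at_Z:
  assumes "wins_at X r i l D a" "D w = 0" "a \<in> V"
  shows "wins_at Z t k m D a"
proof -
  obtain g \<sigma> where g: "\<And>x. x \<in> H \<Longrightarrow> g (r x) - g (r (i x)) = \<sigma> x * l x"
    and D: "\<And>v. v \<in> V \<Longrightarrow> of_bool (v = a) \<le> D v + (\<Sum>x\<in>hedges_at X r v. \<sigma> x)"
    using assms by (auto simp: wins_at_def)
  define g' where "g' = g(w := g (r e) - \<sigma> e)"
  define \<sigma>' where "\<sigma>' = \<sigma>(f := - \<sigma> e, f' := \<sigma> e)"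
  have g'X [simp]: "g' x = g x" if "x \<in> X" for x using that by (auto simp: g'_def)
  have g'w [simp]: "g' w = g (r e) - \<sigma> e" by (simp add: g'_def)
  have \<sigma>'X [simp]: "\<sigma>' x = \<sigma> x" if "x \<in> X" for x using that by (auto simp: \<sigma>'_def)
  have \<sigma>'f [simp]: "\<sigma>' f = - \<sigma> e" "\<sigma>' f' = \<sigma> e" by (auto simp: \<sigma>'_def)
  have ge: "g (r e) - g (r (i e)) = \<sigma> e * l e" using g[OF e] .
  have "\<sigma> (i e) * l e = - \<sigma> e * l e"
    using g[of "i e"] ge lengths(2)[OF e] by simp
  then have \<sigma>i: "\<sigma> (i e) = - \<sigma> e" using long by (metis mult_cancel_right not_numeral_le_zero)
  have "g' (t x) - g' (t (k x)) = \<sigma>' x * m x" if "x \<in> hedges Z t" for x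
    using that
  proof (cases rule: hedges_Z_cases)
    case 1
    then show ?thesis
      using old_hedge[OF 1] g[of x] HX VX[of "r x"] VX[of "r (i x)"] by auto
  qed (use ge \<sigma>i in \<open>auto simp: algebra_simps\<close>)
  moreover have "of_bool (v = a) \<le> D v + (\<Sum>x\<in>hedges_at Z t v. \<sigma>' x)" if "v \<in> verts Z t" for v
  proof (cases "v = w")
    case True
    then show ?thesis using assms(2,3) w_notin_V by (cases "w = a") (simp_all add: hedges_at_w)
  next
    case False
    then have v: "v \<in> V" using that by (simp add: verts_Z)
    have "(\<Sum>x\<in>hedges_at X r v. \<sigma>' x) = (\<Sum>x\<in>hedges_at X r v. \<sigma> x)"
      using HX by (intro sum.cong) (auto simp: hedges_at_def)
    with D[OF v] show ?thesis by (simp add: hedges_at_Z[OF v])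
  qed
  ultimately show ?thesis unfolding wins_at_def by blast
qed

text \<open>Dropping \<open>w\<close> from \<open>T\<close> lowers the bound by 2, so
  \<open>w\<close> may account for only two half-edges. This is clear if at most one end of the
  split edge is in \<open>T\<close>. If both are, \<open>e\<close> and \<open>i e\<close> were
  already counted, because the edge is not a loop.\<close>

lemma forest_Z:
  assumes "forest_at_most_one X r i A" "A \<subseteq> V"
  shows "forest_at_most_one Z t k A"
  unfolding forest_at_most_one_def
proof (intro allI impI)
  fix T assume T: "T \<subseteq> verts Z t" "T \<noteq> {}" "card (T \<inter> A) \<le> 1"
  let ?I = "inner_hedges Z t k"
  define T0 where "T0 = T - {w}"
  have T0V: "T0 \<subseteq> V" using T by (auto simp: T0_def verts_Z)
  have "w \<notin> A" using assms w_notin_V by blast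
  then have "T0 \<inter> A = T \<inter> A" by (auto simp: T0_def)
  then have forest: "card (inner T0) + 2 \<le> 2 * card T0" if "T0 \<noteq> {}"
    using assms(1) T T0V that by (auto simp: forest_at_most_one_def)
  have finT: "finite T" using T(1) by (rule finite_subset) (simp add: verts_Z)
  have old: "x \<in> inner T0" if "x \<in> ?I T" "x \<in> H" "x \<noteq> e" "x \<noteq> i e" for x
    using that old_hedge[of x] VX[of "r x"] VX[of "r (i x)"]
    by (auto simp: inner_hedges_def T0_def)
  have mem: "e \<in> ?I T \<longleftrightarrow> w \<in> T \<and> r e \<in> T" "f \<in> ?I T \<longleftrightarrow> w \<in> T \<and> r e \<in> T"
    "i e \<in> ?I T \<longleftrightarrow> w \<in> T \<and> r (i e) \<in> T" "f' \<in> ?I T \<longleftrightarrow> w \<in> T \<and> r (i e) \<in> T"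
    using e new_neq(1)[of "r e"] new_neq(1)[of "r (i e)"] by (auto simp: inner_hedges_def hedges_Z)
  have sub: "x \<in> inner T0 \<or> x \<in> {e, i e, f, f'}" if "x \<in> ?I T" for x
  proof -
    from that have "x \<in> hedges Z t" by (simp add: inner_hedges_def)
    then show ?thesis using old[OF that] by (cases rule: hedges_Z_cases) auto
  qed
  have card_le: "card (?I T) \<le> card (inner T0) + 2" if "?I T \<subseteq> inner T0 \<union> {a, b}" for a b
  proof -
    have "card (?I T) \<le> card (inner T0 \<union> {a, b})" using that by (intro card_mono) auto
    also have "\<dots> \<le> card (inner T0) + card {a, b}" by (rule card_Un_le)
    also have "card {a, b} \<le> 2" by (simp add: card_insert_if)
    finally show ?thesis by simp
  qed
  show "card (?I T) + 2 \<le> 2 * card T"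
  proof (cases "w \<in> T")
    case False
    then have "?I T \<subseteq> inner T0" using sub mem by blast
    then have "card (?I T) \<le> card (inner T0)" by (intro card_mono) auto
    moreover have "T0 = T" using False by (simp add: T0_def)
    ultimately show ?thesis using forest T by auto
  next
    case True
    then have cardT: "card T = Suc (card T0)" using card_Suc_Diff1[OF finT] by (simp add: T0_def)
    show ?thesis
    proof (cases "T0 = {}")
      case True
      then have "r e \<notin> T" "r (i e) \<notin> T"
        using new_neq(1)[of "r e"] new_neq(1)[of "r (i e)"] by (auto simp: T0_def)
      then have "?I T \<subseteq> inner T0" using sub mem by blast
      then have "?I T = {}" using True by (auto simp: inner_hedges_def)
      then show ?thesis using cardT by simp
    next
      case ne: False
      have "\<exists>a b. ?I T \<subseteq> inner T0 \<union> {a, b}"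
      proof (cases "r e \<in> T \<and> r (i e) \<in> T")
        case both: True
        then have "e \<in> inner T0" "i e \<in> inner T0"
          using e nonloop new_neq(1)[of "r e"] new_neq(1)[of "r (i e)"]
          by (auto simp: inner_hedges_def T0_def)
        then have "?I T \<subseteq> inner T0 \<union> {f, f'}" using sub by blast
        then show ?thesis by blast
      next
        case False
        then have "?I T \<subseteq> inner T0 \<union> {e, f} \<or> ?I T \<subseteq> inner T0 \<union> {i e, f'}"
          using sub mem by blast
        then show ?thesis by blast
      qed
      then have "card (?I T) \<le> card (inner T0) + 2" using card_le by blast
      with forest[OF ne] cardT show ?thesis by simp
    qed
  qed
qed

text \<open>The termination measure of the subdivision: the split edge contributed
  \<open>2 * (l e - 1)\<close>, its two parts together contribute
  \<open>2 * (l e - 2)\<close>.\<close>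

lemma excess_decreases: "(\<Sum>x\<in>hedges Z t. nat (m x - 1)) < (\<Sum>x\<in>H. nat (l x - 1))"
proof -
  let ?H = "H - {e, i e}"
  have "hedges Z t = ?H \<union> {e, i e, f, f'}" using e by (auto simp: hedges_Z)
  moreover have "?H \<inter> {e, i e, f, f'} = {}" using HX fresh by auto
  moreover have "e \<noteq> f" "e \<noteq> f'" "i e \<noteq> f" "i e \<noteq> f'" using eX(1,2) fresh by metis+
  ultimately have 1: "(\<Sum>x\<in>hedges Z t. nat (m x - 1)) =
      (\<Sum>x\<in>?H. nat (m x - 1)) + 2 * nat (l e - 2)"
    by (simp add: sum.union_disjoint)
  have "(\<Sum>x\<in>?H. nat (m x - 1)) = (\<Sum>x\<in>?H. nat (l x - 1))"
    using old_hedge by (intro sum.cong) auto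
  moreover have "(\<Sum>x\<in>H. nat (l x - 1)) = (\<Sum>x\<in>?H. nat (l x - 1)) + (\<Sum>x\<in>{e, i e}. nat (l x - 1))"
    using e by (intro sum.subset_diff) auto
  then have "(\<Sum>x\<in>H. nat (l x - 1)) = (\<Sum>x\<in>?H. nat (l x - 1)) + 2 * nat (l e - 1)"
    using lengths(2)[OF e] by simp
  ultimately show ?thesis using 1 long by simp
qed

end

section \<open>Repeated subdivision\<close>

lemma obtain_fresh3:
  assumes "finite X" "infinite (UNIV :: 'a set)"
  obtains w f f' :: 'a where "w \<notin> X" "f \<notin> X" "f' \<notin> X" "distinct [w, f, f']"
proof -
  obtain w where w: "w \<notin> X" using ex_new_if_finite[OF assms(2,1)] by blast
  obtain f where f: "f \<notin> insert w X" using ex_new_if_finite[OF assms(2), of "insert w X"] assms(1) by blast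
  obtain f' where f': "f' \<notin> insert f (insert w X)"
    using ex_new_if_finite[OF assms(2), of "insert f (insert w X)"] assms(1) by blast
  from w f f' show thesis by (intro that[of w f f']) auto
qed

text \<open>\<open>A\<close> and \<open>D\<close> stay fixed while the graph grows: \<open>A\<close>
  plays the original vertices, and \<open>D\<close> is 0 on every vertex added. The infinite type
  supplies fresh names.\<close>

theorem subdivide_to_unit_lengths:
  fixes X0 X :: "'a set"
  assumes "infinite (UNIV :: 'a set)"
    and "int_graph X r i l" "A \<subseteq> verts X r" "\<forall>v. v \<notin> A \<longrightarrow> D v = 0"
    and "\<forall>a\<in>A. wins_at X r i l D a" "forest_at_most_one X r i A"
    and "subdivision X0 r0 i0 X r i"
  shows "\<exists>X' r' i' l'. subdivision X0 r0 i0 X' r' i' \<and> is_graph X' r' i' \<and> A \<subseteq> verts X' r' \<and>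
    (\<forall>e\<in>hedges X' r'. l' e = 1) \<and> (\<forall>a\<in>A. wins_at X' r' i' l' D a) \<and>
    forest_at_most_one X' r' i' A"
  using assms(2-)
proof (induction "\<Sum>x\<in>hedges X r. nat (l x - 1)" arbitrary: X r i l rule: less_induct)
  case less
  have graph: "is_graph X r i" using less.prems by (simp add: int_graph_def)
  show ?case
  proof (cases "\<forall>e\<in>hedges X r. l e = 1")
    case True
    then show ?thesis using less.prems graph by blast
  next
    case False
    then obtain e where e: "e \<in> hedges X r" "2 \<le> l e"
      using less.prems(1) by (force simp: int_graph_def)
    obtain w f f' where fresh: "w \<notin> X" "f \<notin> X" "f' \<notin> X" "distinct [w, f, f']"
      using obtain_fresh3[OF _ assms(1), of X] graph by (auto simp: is_graph_def)
    interpret edge_split X r i l e w f f'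
      using graph e fresh less.prems(1) by unfold_locales
    have "w \<notin> A" using less.prems(2) w_notin_V by blast
    then have "D w = 0" using less.prems(3) by simp
    show ?thesis
    proof (rule less.hyps[OF excess_decreases int_graph_Z])
      show "A \<subseteq> verts Z t" using less.prems(2) by (auto simp: verts_Z)
      show "\<forall>a\<in>A. wins_at Z t k m D a"
        using wins_at_Z \<open>D w = 0\<close> less.prems by auto
      show "forest_at_most_one Z t k A" using forest_Z less.prems by blast
      show "subdivision X0 r0 i0 Z t k"
        using less.prems(6) subdivision_step_Z by (rule subdivision.step)
    qed (use less.prems in auto)
  qed
qed

section \<open>Gonality\<close>

text \<open>Write each value as a difference and add all the subtrahends at once. The integral
  realisation works with elements of \<open>M\<close>, and a constant shift changes no
  slope.\<close>

lemma Mgp_shift: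
  assumes M: "sharp_integral_monoid M" and "finite V" "\<forall>u\<in>V. g u \<in> Mgp M"
  shows "\<exists>c. \<forall>u\<in>V. g u + c \<in> M"
proof -
  have "\<forall>u\<in>V. \<exists>b. b \<in> M \<and> g u + b \<in> M" using assms(3) by (force simp: Mgp_def)
  then obtain b where b: "\<And>u. u \<in> V \<Longrightarrow> b u \<in> M" "\<And>u. u \<in> V \<Longrightarrow> g u + b u \<in> M" by metis
  have "g u + sum b V \<in> M" if u: "u \<in> V" for u
  proof -
    have "g u + sum b V = (g u + b u) + sum b (V - {u})"
      using assms(2) u by (simp add: sum.remove add.assoc)
    moreover have "sum b (V - {u}) \<in> M" using b(1) by (intro sharp_sum_mem[OF M]) auto
    then have "(g u + b u) + sum b (V - {u}) \<in> M"
      using b(2)[OF u] M unfolding sharp_integral_monoid_def by blast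
    ultimately show ?thesis by (simp only:)
  qed
  then show ?thesis by blast
qed

section \<open>The copy of the graph inside \<open>'a + nat\<close>\<close>

lemma verts_Inl: "verts (Inl ` X) (map_sum r id) = Inl ` verts X r"
  and hedges_Inl: "hedges (Inl ` X) (map_sum r id) = Inl ` hedges X r"
  and hedges_at_Inl: "hedges_at (Inl ` X) (map_sum r id) (Inl v) = Inl ` hedges_at X r v"
  by (auto simp: verts_def hedges_def hedges_at_def)

lemma is_graph_Inl:
  assumes "is_graph X r i"
  shows "is_graph (Inl ` X) (map_sum r id) (map_sum i id)"
proof -
  have "(Inl u, Inl v) \<in> (adj_rel (Inl ` X) (map_sum r id) (map_sum i id))\<^sup>*"
    if "(u, v) \<in> (adj_rel X r i)\<^sup>*" for u v
    using that
  proof induction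
    case (step y z)
    then have "(Inl y, Inl z) \<in> adj_rel (Inl ` X) (map_sum r id) (map_sum i id)"
      by (force simp: adj_rel_def hedges_Inl)
    with step.IH show ?case by (rule rtrancl_into_rtrancl)
  qed simp
  moreover have "\<forall>u\<in>verts X r. \<forall>v\<in>verts X r. (u, v) \<in> (adj_rel X r i)\<^sup>*"
    using assms by (simp add: is_graph_def)
  ultimately have conn: "\<forall>u\<in>Inl ` verts X r. \<forall>v\<in>Inl ` verts X r.
      (u, v) \<in> (adj_rel (Inl ` X) (map_sum r id) (map_sum i id))\<^sup>*" by blast
  show ?thesis
    using assms unfolding is_graph_def verts_Inl by (intro conjI conn) auto
qed

lemma forest_verts:
  assumes "finite X"
  shows "forest_at_most_one X r i (verts X r)"
  unfolding forest_at_most_one_def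
proof (intro allI impI)
  fix T assume T: "T \<subseteq> verts X r" "T \<noteq> {}" "card (T \<inter> verts X r) \<le> 1"
  have finT: "finite T" using T(1) assms by (auto simp: verts_def intro: finite_subset)
  have "T \<inter> verts X r = T" using T(1) by blast
  with T finT have "card T = 1" by (metis One_nat_def card_0_eq le_antisym less_one not_le)
  then obtain x where "T = {x}" by (metis card_1_singletonE)
  then have "inner_hedges X r i T = {}" by (auto simp: inner_hedges_def)
  with \<open>card T = 1\<close> show "card (inner_hedges X r i T) + 2 \<le> 2 * card T" by simp
qed

text \<open>For unit lengths every integer function is piecewise linear and \<open>Laplacian\<close>
  becomes \<open>lap\<close>, so winning against each vertex gives rank at least one.\<close>

lemma udgon_le:
  assumes graph: "is_graph X r i" and D: "divisor X r D" "deg X r D = int n"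
    and wins: "\<And>v. v \<in> verts X r \<Longrightarrow>
      \<exists>g. \<forall>u\<in>verts X r. of_bool (u = v) \<le> D u + fin_graph.lap X r i g u"
  shows "udgon X r i \<le> n"
proof -
  define l where "l x = (if r x = x then 0 else 1 :: int)" for x
  interpret fin_graph X r i using graph by unfold_locales
  have l1: "l e = 1" if "e \<in> H" for e using that by (auto simp: l_def hedges_def verts_def)
  interpret m_graph X r i "{n::int. 0 \<le> n}" l
  proof
    show "sharp_integral_monoid {n::int. 0 \<le> n}" by (simp add: sharp_integral_monoid_def)
    have "l (i x) = l x" if "x \<in> X" for x
      using that graph hedge_ends(2)[of x] l1[of x] l1[of "i x"]
      by (cases "x \<in> V") (auto simp: hedges_def l_def verts_def is_graph_def)
    then show "metrised_graph {n. 0 \<le> n} X r i l"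
      using graph by (auto simp: metrised_graph_def l_def verts_def)
  qed
  have PL: "g \<in> PL {n. 0 \<le> n} X r i l" for g
  proof -
    have "x \<in> Mgp {n::int. 0 \<le> n}" for x
    proof -
      have "x = max x 0 - max (- x) 0" "0 \<le> max x 0" "0 \<le> max (- x) 0" by auto
      then show ?thesis unfolding Mgp_def by blast
    qed
    moreover have "x \<in> zspan 1" for x :: int by (auto simp: zspan_def zsmul_int)
    ultimately show ?thesis using l1 by (simp add: PL_def)
  qed
  have Lap: "Laplacian X r i l g u = lap g u" if "u \<in> V" for g u
    using that l1 unfolding Laplacian_slope[OF that] lap_def
    by (intro sum.cong) (auto simp: hedges_at_def zsmul_int intro!: slope_eqI)
  have "1 \<le> rank {n. 0 \<le> n} X r i l D"
    unfolding rank_ge_1_iff[OF D(1)]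
  proof
    fix v assume "v \<in> V"
    then obtain g where "\<forall>u\<in>V. of_bool (u = v) \<le> D u + lap g u" using wins by blast
    then show "\<exists>g\<in>PL {n. 0 \<le> n} X r i l. \<forall>u\<in>V. of_bool (u = v) \<le> D u + Laplacian X r i l g u"
      using PL by (intro bexI[of _ g]) (simp_all add: Lap)
  qed
  then show ?thesis
    using D unfolding udgon_def dgon_def l_def[abs_def, symmetric] by (intro Least_le) blast
qed

theorem theorem4p11:
  fixes M :: "'g::ab_group_add set" and X :: "'a set" and r i :: "'a \<Rightarrow> 'a"
    and l :: "'a \<Rightarrow> 'g"
  assumes "sharp_integral_monoid M"
    and "metrised_graph M X r i l"
  shows "\<exists>(X' :: ('a + nat) set) r' i'.
           subdivision (Inl ` X) (map_sum r id) (map_sum i id) X' r' i' \<and>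
           udgon X' r' i' \<le> dgon M X r i l"
proof -
  interpret m_graph X r i M l
    by unfold_locales (use assms in \<open>auto simp: metrised_graph_def\<close>)
  obtain D where D: "divisor X r D" "deg X r D = int (dgon M X r i l)" "1 \<le> rank M X r i l D"
    by (rule dgon_attained)
  then obtain g where g: "\<And>v. v \<in> V \<Longrightarrow> g v \<in> PL M X r i l"
    "\<And>v u. v \<in> V \<Longrightarrow> u \<in> V \<Longrightarrow> of_bool (u = v) \<le> D u + Laplacian X r i l (g v) u"
    unfolding rank_ge_1_iff[OF D(1)] by metis
  have "\<forall>v\<in>V. \<exists>c. \<forall>u\<in>V. g v u + c \<in> M"
    using g(1) by (intro ballI Mgp_shift[OF sharp]) (auto simp: PL_def)
  then obtain c where c: "\<And>v u. v \<in> V \<Longrightarrow> u \<in> V \<Longrightarrow> g v u + c v \<in> M" by metis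
  define G where "G v u = g v u + c v" for v u
  define S where "S = l ` H \<union> (\<lambda>(v, u). G v u) ` (V \<times> V)"
  define T where "T = (\<lambda>(v, e). (G v (r e), G v (r (i e)), slope (g v) e, l e)) ` (V \<times> H)"
  have "\<exists>y :: 'g \<Rightarrow> int. (\<forall>x\<in>S. x \<noteq> 0 \<longrightarrow> 0 < y x) \<and> (\<forall>(a, b, k, c)\<in>T. y a - y b = k * y c)"
  proof (rule sharp_monoid_integral_realisation[OF sharp])
    show "S \<subseteq> M" using c length_hedge by (auto simp: S_def G_def)
    fix a b k c' assume "(a, b, k, c') \<in> T"
    then obtain v e where ve: "v \<in> V" "e \<in> H" and
      eq: "a = G v (r e)" "b = G v (r (i e))" "k = slope (g v) e" "c' = l e"
      by (auto simp: T_def)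
    have "a - b = zsmul k c'" using zsmul_slope[OF g(1) ve(2)] ve(1) by (simp add: eq G_def)
    then show "a \<in> S \<and> b \<in> S \<and> c' \<in> S \<and> a - b = zsmul k c'"
      using ve hedge_ends[OF ve(2)] by (auto simp: eq S_def)
  qed (auto simp: S_def T_def)
  then obtain y :: "'g \<Rightarrow> int" where y: "\<And>e. e \<in> H \<Longrightarrow> 0 < y (l e)"
    "\<And>v e. v \<in> V \<Longrightarrow> e \<in> H \<Longrightarrow> y (G v (r e)) - y (G v (r (i e))) = slope (g v) e * y (l e)"
    using length_hedge by (fastforce simp: S_def T_def)
  let ?X = "Inl ` X :: ('a + nat) set" and ?r = "map_sum r id" and ?i = "map_sum i id"
  \<comment> \<open>Resetting loops to length 1 is harmless: the difference along a loop is 0, hence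
    so is its slope.\<close>
  define L :: "'a + nat \<Rightarrow> int" where
    "L = case_sum (\<lambda>e. if r e = r (i e) then 1 else y (l e)) (\<lambda>_. 1)"
  define D' :: "'a + nat \<Rightarrow> int" where "D' = case_sum D (\<lambda>_. 0)"
  let ?A = "Inl ` V :: ('a + nat) set"
  have int: "int_graph ?X ?r ?i L"
    unfolding int_graph_def
    using is_graph_Inl[OF graph] y(1) length_hedge by (force simp: hedges_Inl L_def)
  have D'_off: "\<forall>v. v \<notin> ?A \<longrightarrow> D' v = 0"
    using D(1) by (auto simp: D'_def divisor_def split: sum.split)
  have wins: "\<forall>a\<in>?A. wins_at ?X ?r ?i L D' a"
  proof
    fix a assume "a \<in> ?A"
    then obtain v where v: "v \<in> V" "a = Inl v" by auto
    define \<phi> :: "'a + nat \<Rightarrow> int" where "\<phi> = case_sum (\<lambda>u. y (G v u)) (\<lambda>_. 0)"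
    define \<sigma> :: "'a + nat \<Rightarrow> int" where "\<sigma> = case_sum (slope (g v)) (\<lambda>_. 0)"
    have "\<phi> (Inl (r e)) - \<phi> (Inl (r (i e))) = \<sigma> (Inl e) * L (Inl e)" if e: "e \<in> H" for e
      using y(2)[OF v(1) e] slope_eqI[OF e, of "g v" 0] by (auto simp: \<phi>_def \<sigma>_def L_def)
    moreover have "of_bool (Inl u = a) \<le> D' (Inl u) + (\<Sum>e\<in>Inl ` hedges_at X r u. \<sigma> e)"
      if u: "u \<in> V" for u
      using g(2)[OF v(1) u]
      by (simp add: D'_def v(2) \<sigma>_def sum.reindex Laplacian_slope[OF u])
    ultimately show "wins_at ?X ?r ?i L D' a"
      unfolding wins_at_def
      by (intro exI[of _ \<phi>] exI[of _ \<sigma>]) (auto simp: hedges_Inl verts_Inl hedges_at_Inl)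
  qed
  obtain X' r' i' l' where
    sub: "subdivision ?X ?r ?i X' r' i'" and graph': "is_graph X' r' i'" and
    A: "?A \<subseteq> verts X' r'" and l': "\<forall>e\<in>hedges X' r'. l' e = 1" and
    wins': "\<forall>a\<in>?A. wins_at X' r' i' l' D' a" and forest': "forest_at_most_one X' r' i' ?A"
  proof -
    have "infinite (UNIV :: ('a + nat) set)"
      by (metis finite_Plus_UNIV_iff infinite_UNIV_nat)
    moreover have "forest_at_most_one ?X ?r ?i ?A" 
      using forest_verts[of ?X ?r ?i] graph by (simp add: verts_Inl is_graph_def)
    ultimately show thesis
      using subdivide_to_unit_lengths[OF _ int _ D'_off wins _ subdivision.refl] that
      by (auto simp: verts_Inl)
  qed
  interpret H: fin_graph X' r' i' using graph' by unfold_locales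
  have "udgon X' r' i' \<le> dgon M X r i l"
  proof (rule udgon_le[OF graph'])
    show "divisor X' r' D'" using D'_off A by (auto simp: divisor_def)
    have "deg X' r' D' = (\<Sum>v\<in>?A. D' v)"
      unfolding deg_def using A D'_off by (intro sum.mono_neutral_right) auto
    also have "\<dots> = deg X r D" by (simp add: sum.reindex D'_def deg_def)
    finally show "deg X' r' D' = int (dgon M X r i l)" using D(2) by simp
    \<comment> \<open>With all lengths 1 the slopes are the differences of \<open>g\<close>, so
      their sum at a vertex is \<open>lap\<close>.\<close>
    have unit: "\<exists>g. \<forall>v\<in>verts X' r'. of_bool (v = a) \<le> D' v + H.lap g v" if a: "a \<in> ?A" for a
    proof -
      obtain g \<sigma> where g: "\<forall>e\<in>hedges X' r'. g (r' e) - g (r' (i' e)) = \<sigma> e * l' e"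
        "\<forall>v\<in>verts X' r'. of_bool (v = a) \<le> D' v + (\<Sum>e\<in>hedges_at X' r' v. \<sigma> e)"
        using wins' a unfolding wins_at_def by blast
      have "H.lap g v = (\<Sum>e\<in>hedges_at X' r' v. \<sigma> e)" for v
        unfolding H.lap_def using g(1) l' by (intro sum.cong) (auto simp: hedges_at_def)
      with g(2) show ?thesis by (intro exI[of _ g]) simp
    qed
    fix v assume "v \<in> verts X' r'"
    then show "\<exists>g. \<forall>u\<in>verts X' r'. of_bool (u = v) \<le> D' u + H.lap g u"
      using V_nonempty by (intro H.rank_determining[OF A _ forest' unit]) auto
  qed
  with sub show ?thesis by blast
qed

end
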